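(* Vertex Cover by CVD cannot be solved in ${\mathcal O}^*((2- \epsilon)^{k})$ time for any $\epsilon >0$ assuming the Strong Exponential Time Hypothesis (SETH).
   Context: Vertex Cover by CVD: given a graph $G$ and integers $k,\ell$, with parameter $k$ the size of a chordal vertex deletion set of $G$, decide whether $G$ has a vertex cover of size $\ell$. ${\mathcal O}^*$ hides factors polynomial in the input size. The lower bound holds even when a chordal vertex deletion set of size $k$ is given in the input. *)

theory Defs
  imports Complex_Main "HOL-Library.Log_Nat"
begin

section \<open>Random access machines with logarithmic cost\<close>

text \<open>
  Programs act on numbered registers and a memory with indirect addressing, both holding natural
  numbers. Every step is charged one plus the bit lengths of the numbers and addresses it
  handles. \<open>Sub\<close> is truncated subtraction; \<open>Cond\<close> and \<open>While\<close> branch on the register being nonzero.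
\<close>

type_synonym state = "(nat \<Rightarrow> nat) \<times> (nat \<Rightarrow> nat)"

datatype com =
    Imm nat nat
  | Add nat nat nat
  | Sub nat nat nat
  | Load nat nat
  | Store nat nat
  | Seq com com
  | Cond nat com com
  | While nat com

abbreviation bits :: "nat \<Rightarrow> nat" where
  "bits n \<equiv> floorlog 2 n"

inductive exec :: "com \<Rightarrow> state \<Rightarrow> nat \<Rightarrow> state \<Rightarrow> bool" where
  Imm: "exec (Imm r n) (R, M) (1 + bits n) (R(r := n), M)"
| Add: "exec (Add r a b) (R, M) (1 + bits (R a) + bits (R b)) (R(r := R a + R b), M)"
| Sub: "exec (Sub r a b) (R, M) (1 + bits (R a) + bits (R b)) (R(r := R a - R b), M)"
| Load: "exec (Load r a) (R, M) (1 + bits (R a) + bits (M (R a))) (R(r := M (R a)), M)"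
| Store: "exec (Store a r) (R, M) (1 + bits (R a) + bits (R r)) (R, M(R a := R r))"
| Seq: "exec c1 s t1 s' \<Longrightarrow> exec c2 s' t2 s'' \<Longrightarrow> exec (Seq c1 c2) s (t1 + t2) s''"
| Cond_True: "R r \<noteq> 0 \<Longrightarrow> exec c1 (R, M) t s' \<Longrightarrow>
    exec (Cond r c1 c2) (R, M) (1 + bits (R r) + t) s'"
| Cond_False: "R r = 0 \<Longrightarrow> exec c2 (R, M) t s' \<Longrightarrow>
    exec (Cond r c1 c2) (R, M) (1 + bits (R r) + t) s'"
| While_True: "R r \<noteq> 0 \<Longrightarrow> exec c (R, M) t1 s' \<Longrightarrow> exec (While r c) s' t2 s'' \<Longrightarrow>
    exec (While r c) (R, M) (1 + bits (R r) + t1 + t2) s''"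
| While_False: "R r = 0 \<Longrightarrow> exec (While r c) (R, M) (1 + bits (R r)) (R, M)"

inductive_cases exec_ImmE: "exec (Imm r n) s t s'"
inductive_cases exec_AddE: "exec (Add r a b) s t s'"
inductive_cases exec_SubE: "exec (Sub r a b) s t s'"
inductive_cases exec_LoadE: "exec (Load r a) s t s'"
inductive_cases exec_StoreE: "exec (Store a r) s t s'"
inductive_cases exec_SeqE: "exec (Seq c1 c2) s t s'"
inductive_cases exec_CondE: "exec (Cond r c1 c2) s t s'"
inductive_cases exec_WhileE: "exec (While r c) s t s'"

lemma exec_deterministic:
  "exec c s t s' \<Longrightarrow> exec c s u s'' \<Longrightarrow> u = t \<and> s'' = s'"
proof (induction arbitrary: u s'' rule: exec.induct)
  case (Seq c1 s t1 s' c2 t2 s2)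
  from Seq.prems obtain a m b where ab: "u = a + b" "exec c1 s a m" "exec c2 m b s''"
    by (rule exec_SeqE) simp
  with Seq.IH(1)[OF ab(2)] Seq.IH(2)[of b s''] show ?case by simp
next
  case (Cond_True R r c1 M t s' c2)
  from Cond_True.prems Cond_True.hyps obtain a where
    a: "u = 1 + bits (R r) + a" "exec c1 (R, M) a s''"
    by (elim exec_CondE) simp_all
  with Cond_True.IH[OF a(2)] show ?case by simp
next
  case (Cond_False R r c2 M t s' c1)
  from Cond_False.prems Cond_False.hyps obtain a where
    a: "u = 1 + bits (R r) + a" "exec c2 (R, M) a s''"
    by (elim exec_CondE) simp_all
  with Cond_False.IH[OF a(2)] show ?case by simp
next
  case (While_True R r c M t1 s' t2 s2)
  from While_True.prems obtain a m b where
    ab: "u = 1 + bits (R r) + a + b" "exec c (R, M) a m" "exec (While r c) m b s''"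
    by (rule exec_WhileE) (use While_True.hyps in simp_all)
  with While_True.IH(1)[OF ab(2)] While_True.IH(2)[of b s''] show ?case by simp
next
  case (While_False R r c M)
  from While_False.prems show ?case by (rule exec_WhileE) (use While_False.hyps in simp_all)
next
  case (Imm r n R M) then show ?case by (elim exec_ImmE) simp
next
  case (Add r a R b M) then show ?case by (elim exec_AddE) simp
next
  case (Sub r a R b M) then show ?case by (elim exec_SubE) simp
next
  case (Load r a R M) then show ?case by (elim exec_LoadE) simp
next
  case (Store a r R M) then show ?case by (elim exec_StoreE) simp
qed

text \<open>
  The input word occupies the initial memory cells, register 0 holds its length, and everything
  else is 0. A halting program accepts iff it leaves a nonzero value in register 0.
\<close>

definition init :: "nat list \<Rightarrow> state" where
  "init xs = ((\<lambda>r. if r = 0 then length xs else 0), (\<lambda>i. if i < length xs then xs ! i else 0))"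

definition accepting :: "state \<Rightarrow> bool" where
  "accepting s \<longleftrightarrow> fst s 0 \<noteq> 0"

definition input_size :: "nat list \<Rightarrow> nat" where
  "input_size xs = (\<Sum>x\<leftarrow>xs. 1 + bits x)"


section \<open>Parameterized problems\<close>

text \<open>
  Problems are promise problems: nothing is required of a program on words that do not
  encode a member of \<open>instances\<close>.
\<close>

record 'i param_problem =
  instances :: "'i set"
  encode :: "'i \<Rightarrow> nat list"
  param :: "'i \<Rightarrow> nat"
  yes_instance :: "'i \<Rightarrow> bool"

text \<open>Solvable in time \<open>f(k) \<cdot> |x|\<^sup>O\<^sup>(\<^sup>1\<^sup>)\<close>, that is \<open>O\<^sup>*(f(k))\<close>, where \<open>k\<close> is the parameter.\<close>

definition solvable_Ostar :: "'i param_problem \<Rightarrow> (nat \<Rightarrow> real) \<Rightarrow> bool" where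
  "solvable_Ostar \<Pi> f \<longleftrightarrow>
    (\<exists>P (C::real) (c::nat). C > 0 \<and> (\<forall>x \<in> instances \<Pi>. \<exists>t s.
        exec P (init (encode \<Pi> x)) t s \<and>
        (accepting s \<longleftrightarrow> yes_instance \<Pi> x) \<and>
        real t \<le> C * f (param \<Pi> x) * real (input_size (encode \<Pi> x)) ^ c))"


section \<open>Satisfiability and SETH\<close>

text \<open>The literal \<open>(v, True)\<close> is the variable \<open>v\<close>, and \<open>(v, False)\<close> its negation.\<close>

type_synonym literal = "nat \<times> bool"
type_synonym cnf = "literal list list"

definition satisfiable :: "cnf \<Rightarrow> bool" where
  "satisfiable F \<longleftrightarrow> (\<exists>\<alpha> :: nat \<Rightarrow> bool. \<forall>c \<in> set F. \<exists>(v, b) \<in> set c. \<alpha> v = b)"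

definition is_qcnf :: "nat \<Rightarrow> nat \<Rightarrow> cnf \<Rightarrow> bool" where
  "is_qcnf q n F \<longleftrightarrow> (\<forall>c \<in> set F. length c \<le> q \<and> (\<forall>(v, b) \<in> set c. v < n))"

fun encode_literal :: "literal \<Rightarrow> nat" where
  "encode_literal (v, b) = 2 * v + of_bool b"

definition encode_cnf :: "nat \<Rightarrow> cnf \<Rightarrow> nat list" where
  "encode_cnf n F = n # length F # concat (map (\<lambda>c. length c # map encode_literal c) F)"

definition SAT :: "nat \<Rightarrow> (nat \<times> cnf) param_problem" where
  "SAT q = \<lparr> instances = {(n, F). is_qcnf q n F},
             encode = (\<lambda>(n, F). encode_cnf n F),
             param = (\<lambda>(n, F). n),
             yes_instance = (\<lambda>(n, F). satisfiable F) \<rparr>"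

definition SETH :: bool where
  "SETH \<longleftrightarrow> (\<forall>\<delta>::real. \<delta> < 1 \<longrightarrow>
     (\<exists>q. \<not> solvable_Ostar (SAT q) (\<lambda>n. 2 powr (\<delta> * real n))))"


section \<open>Chordal vertex deletion sets and vertex covers\<close>

definition simple_graph :: "'a set \<Rightarrow> 'a set set \<Rightarrow> bool" where
  "simple_graph V E \<longleftrightarrow> finite V \<and> (\<forall>e \<in> E. e \<subseteq> V \<and> card e = 2)"

definition vertex_cover :: "'a set \<Rightarrow> 'a set set \<Rightarrow> 'a set \<Rightarrow> bool" where
  "vertex_cover V E X \<longleftrightarrow> X \<subseteq> V \<and> (\<forall>e \<in> E. e \<inter> X \<noteq> {})"

definition is_cycle :: "'a set \<Rightarrow> 'a set set \<Rightarrow> 'a list \<Rightarrow> bool" where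
  "is_cycle V E vs \<longleftrightarrow> length vs \<ge> 3 \<and> distinct vs \<and> set vs \<subseteq> V \<and>
     (\<forall>i < length vs. {vs ! i, vs ! (Suc i mod length vs)} \<in> E)"

definition has_chord :: "'a set set \<Rightarrow> 'a list \<Rightarrow> bool" where
  "has_chord E vs \<longleftrightarrow> (\<exists>i < length vs. \<exists>j < length vs.
     i \<noteq> j \<and> j \<noteq> Suc i mod length vs \<and> i \<noteq> Suc j mod length vs \<and> {vs ! i, vs ! j} \<in> E)"

definition chordal :: "'a set \<Rightarrow> 'a set set \<Rightarrow> bool" where
  "chordal V E \<longleftrightarrow> (\<forall>vs. is_cycle V E vs \<and> length vs \<ge> 4 \<longrightarrow> has_chord E vs)"

definition chordal_deletion_set :: "'a set \<Rightarrow> 'a set set \<Rightarrow> 'a set \<Rightarrow> bool" where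
  "chordal_deletion_set V E S \<longleftrightarrow> S \<subseteq> V \<and> chordal (V - S) {e \<in> E. e \<inter> S = {}}"

text \<open>Machine inputs are graphs on \<open>{0..<n}\<close>, given by their adjacency matrix.\<close>

definition adjacency_bits :: "nat \<Rightarrow> nat set set \<Rightarrow> nat list" where
  "adjacency_bits n E = concat (map (\<lambda>u. map (\<lambda>v. of_bool ({u, v} \<in> E)) [0..<n]) [0..<n])"

definition membership_bits :: "nat \<Rightarrow> nat set \<Rightarrow> nat list" where
  "membership_bits n S = map (\<lambda>v. of_bool (v \<in> S)) [0..<n]"

text \<open>Instances are \<open>(n, E, k, l)\<close>, with the promise that a chordal deletion set of size \<open>k\<close> exists.\<close>

definition VC_by_CVD :: "(nat \<times> nat set set \<times> nat \<times> nat) param_problem" where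
  "VC_by_CVD = \<lparr>
     instances = {(n, E, k, l). simple_graph {0..<n} E \<and>
                    (\<exists>S. chordal_deletion_set {0..<n} E S \<and> card S = k)},
     encode = (\<lambda>(n, E, k, l). n # k # l # adjacency_bits n E),
     param = (\<lambda>(n, E, k, l). k),
     yes_instance = (\<lambda>(n, E, k, l). \<exists>X. vertex_cover {0..<n} E X \<and> card X = l) \<rparr>"

text \<open>The variant in which a chordal deletion set \<open>S\<close> of size \<open>k\<close> is part of the input.\<close>

definition VC_by_given_CVD :: "(nat \<times> nat set set \<times> nat set \<times> nat \<times> nat) param_problem" where
  "VC_by_given_CVD = \<lparr>
     instances = {(n, E, S, k, l). simple_graph {0..<n} E \<and>
                    chordal_deletion_set {0..<n} E S \<and> card S = k},
     encode = (\<lambda>(n, E, S, k, l). n # k # l # adjacency_bits n E @ membership_bits n S),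
     param = (\<lambda>(n, E, S, k, l). k),
     yes_instance = (\<lambda>(n, E, S, k, l). \<exists>X. vertex_cover {0..<n} E X \<and> card X = l) \<rparr>"

end

theory Submission
  imports Defs "HOL-Library.Nat_Bijection"
begin

text \<open>
  Split the \<open>n\<close> variables of a \<open>q\<close>-CNF formula into groups of \<open>p\<close> and represent a group by a block of \<open>2 * h\<close>
  elements. If \<open>2 ^ p\<close> is at most the central binomial coefficient of \<open>2 * h\<close>, every assignment of the group is
  encoded by a half-size subset of the block. A set of at most half of all elements that hits every subset of a block
  larger than half of it meets each block in exactly half, and a constant number of further sets per clause rules out
  the falsifying choices. Hitting sets become vertex covers by adding for each set a clique with one vertex per
  element, attached to that element: all clique vertices but one are in the cover, and the missing one names an
  element that hits the set. Removing the elements leaves disjoint cliques, so the elements form a chordal deletion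
  set, of size \<open>2 * h * (n div p + 1)\<close>. For \<open>2 * h = 2 ^ J\<close> and \<open>p = 2 ^ J - J\<close> the quotient \<open>2 * h / p\<close> tends
  to 1, so an algorithm with base below 2 would give one for \<open>q\<close>-SAT, with base below 2 independent of \<open>q\<close>. The
  number \<open>n\<close> may be exponential in the input size, but polynomial factors in \<open>n\<close> are absorbed by the exponential.
\<close>

section \<open>Upper bounds for running times\<close>

text \<open>
  Only upper bounds on running times matter. A step may therefore be charged the numbers it handles instead of
  their bit lengths.
\<close>

definition wp :: "com \<Rightarrow> state \<Rightarrow> (nat \<Rightarrow> state \<Rightarrow> bool) \<Rightarrow> bool" where
  "wp P s Q \<longleftrightarrow> (\<exists>t u s'. exec P s t s' \<and> t \<le> u \<and> Q u s')"

abbreviation runs :: "com \<Rightarrow> state \<Rightarrow> nat \<Rightarrow> (state \<Rightarrow> bool) \<Rightarrow> bool" where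
  "runs P s T Q \<equiv> wp P s (\<lambda>t s'. t \<le> T \<and> Q s')"

lemma wpI: "exec P s t s' \<Longrightarrow> t \<le> u \<Longrightarrow> Q u s' \<Longrightarrow> wp P s Q"
  unfolding wp_def by blast

lemma runsE:
  assumes "runs P s T Q"
  obtains t s' where "exec P s t s'" "t \<le> T" "Q s'"
  using assms le_trans unfolding wp_def by blast

lemma wp_mono: "wp P s Q \<Longrightarrow> (\<And>t s'. Q t s' \<Longrightarrow> Q' t s') \<Longrightarrow> wp P s Q'"
  unfolding wp_def by blast

lemma runs_mono: "runs P s T Q \<Longrightarrow> T \<le> T' \<Longrightarrow> (\<And>s'. Q s' \<Longrightarrow> Q' s') \<Longrightarrow> runs P s T' Q'"
  by (erule wp_mono) auto

lemma bits_le: "bits n \<le> n"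
  by (rule floorlog_leI) auto

lemma wp_Imm: "Q (1 + n) (R(r := n), M) \<Longrightarrow> wp (Imm r n) (R, M) Q"
  by (rule wpI[OF exec.Imm]) (simp_all add: bits_le)

lemma wp_Add: "Q (1 + R a + R b) (R(r := R a + R b), M) \<Longrightarrow> wp (Add r a b) (R, M) Q"
  by (rule wpI[OF exec.Add]) (simp_all add: bits_le add_mono)

lemma wp_Sub: "Q (1 + R a + R b) (R(r := R a - R b), M) \<Longrightarrow> wp (Sub r a b) (R, M) Q"
  by (rule wpI[OF exec.Sub]) (simp_all add: bits_le add_mono)

lemma wp_Load: "Q (1 + R a + M (R a)) (R(r := M (R a)), M) \<Longrightarrow> wp (Load r a) (R, M) Q"
  by (rule wpI[OF exec.Load]) (simp_all add: bits_le add_mono)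

lemma wp_Store: "Q (1 + R a + R r) (R, M(R a := R r)) \<Longrightarrow> wp (Store a r) (R, M) Q"
  by (rule wpI[OF exec.Store]) (simp_all add: bits_le add_mono)

lemma wp_Seq:
  assumes "wp P1 s (\<lambda>t1 s1. wp P2 s1 (\<lambda>t2 s2. Q (t1 + t2) s2))"
  shows "wp (Seq P1 P2) s Q"
proof -
  from assms obtain t1 u1 s1 t2 u2 s2 where "exec P1 s t1 s1" "t1 \<le> u1" "exec P2 s1 t2 s2" "t2 \<le> u2" "Q (u1 + u2) s2"
    unfolding wp_def by blast
  then show ?thesis by (intro wpI[OF exec.Seq]) auto
qed

lemma wp_Cond:
  assumes "R r \<noteq> 0 \<Longrightarrow> wp P1 (R, M) (\<lambda>t s. Q (1 + R r + t) s)"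
    and "R r = 0 \<Longrightarrow> wp P2 (R, M) (\<lambda>t s. Q (1 + R r + t) s)"
  shows "wp (Cond r P1 P2) (R, M) Q"
proof (cases "R r = 0")
  case True
  with assms(2) obtain t u s where "exec P2 (R, M) t s" "t \<le> u" "Q (1 + R r + u) s" unfolding wp_def by blast
  then show ?thesis by (intro wpI[OF exec.Cond_False[of R r, OF True]]) (auto intro: add_mono bits_le)
next
  case False
  with assms(1) obtain t u s where "exec P1 (R, M) t s" "t \<le> u" "Q (1 + R r + u) s" unfolding wp_def by blast
  then show ?thesis by (intro wpI[OF exec.Cond_True[of R r, OF False]]) (auto intro: add_mono bits_le)
qed

lemmas wp_intros = wp_Imm wp_Add wp_Sub wp_Load wp_Store wp_Seq wp_Cond

lemma runs_Seq:
  assumes "runs P1 s T1 Q1" "\<And>s'. Q1 s' \<Longrightarrow> runs P2 s' T2 Q2"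
  shows "runs (Seq P1 P2) s (T1 + T2) Q2"
  by (intro wp_Seq wp_mono[OF assms(1)], elim conjE, rule wp_mono[OF assms(2)]) auto

definition copy :: "nat \<Rightarrow> nat \<Rightarrow> com" where
  "copy d x = Seq (Imm d 0) (Add d d x)"

lemma wp_copy: "d \<noteq> x \<Longrightarrow> Q (2 + R x) (R(d := R x), M) \<Longrightarrow> wp (copy d x) (R, M) Q"
  unfolding copy_def by (intro wp_intros) simp

definition count_step :: "nat \<Rightarrow> com" where
  "count_step c = Seq (Imm (c + 2) 1) (Seq (Add (c + 1) (c + 1) (c + 2)) (Sub c c (c + 2)))"

definition for_loop :: "nat \<Rightarrow> com \<Rightarrow> com" where
  "for_loop c B = Seq (Imm (c + 1) 0) (While c (Seq B (count_step c)))"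

definition loop_time :: "nat \<Rightarrow> nat \<Rightarrow> nat" where
  "loop_time n T = (n + 1) * (T + 2 * n + 7)"

lemma wp_count_step:
  assumes "Q (6 + R (c + 1) + R c) (R(c + 2 := 1, c + 1 := R (c + 1) + 1, c := R c - 1), M)"
  shows "wp (count_step c) (R, M) Q"
  unfolding count_step_def using assms by (intro wp_intros) (simp add: numeral_eq_Suc ac_simps fun_upd_twist)

context
  fixes Inv :: "nat \<Rightarrow> (nat \<Rightarrow> nat) \<Rightarrow> (nat \<Rightarrow> nat) \<Rightarrow> bool" and c n T :: nat and B :: com
  assumes frame: "\<And>i R M x y z. Inv i R M \<Longrightarrow> Inv i (R(c + 2 := x, c + 1 := y, c := z)) M"
    and body: "\<And>i R M. i < n \<Longrightarrow> Inv i R M \<Longrightarrow> R c = n - i \<Longrightarrow> R (c + 1) = i \<Longrightarrow>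
      runs B (R, M) T (\<lambda>(R', M'). R' c = n - i \<and> R' (c + 1) = i \<and> Inv (Suc i) R' M')"
begin

lemma runs_counted_while:
  "k \<le> n \<Longrightarrow> Inv (n - k) R M \<Longrightarrow> R c = k \<Longrightarrow> R (c + 1) = n - k \<Longrightarrow>
    runs (While c (Seq B (count_step c))) (R, M) (1 + k * (T + 2 * n + 7)) (\<lambda>(R', M'). Inv n R' M')"
proof (induction k arbitrary: R M)
  case 0
  then show ?case using exec.While_False[of R c] by (intro wpI) (auto simp: floorlog_def)
next
  case (Suc k)
  let ?i = "n - Suc k"
  have i: "?i < n" "n - ?i = Suc k" "Suc ?i = n - k" using Suc.prems(1) by simp_all
  have "runs (Seq B (count_step c)) (R, M) (T + (6 + n))
      (\<lambda>(R', M'). R' c = k \<and> R' (c + 1) = n - k \<and> Inv (n - k) R' M')"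
  proof (rule runs_Seq[OF body[OF i(1) Suc.prems(2)]])
    fix s assume "case s of (R', M') \<Rightarrow> R' c = n - ?i \<and> R' (c + 1) = ?i \<and> Inv (Suc ?i) R' M'"
    then obtain R' M' where "s = (R', M')" "R' c = Suc k" "R' (c + 1) = ?i" "Inv (n - k) R' M'"
      using i by (cases s) auto
    then show "runs (count_step c) s (6 + n) (\<lambda>(R', M'). R' c = k \<and> R' (c + 1) = n - k \<and> Inv (n - k) R' M')"
      using frame[of "n - k" R' M'] i Suc.prems(1) by (auto intro!: wp_count_step)
  qed (use Suc.prems i in simp_all)
  then obtain t1 R1 M1 where first: "exec (Seq B (count_step c)) (R, M) t1 (R1, M1)" "t1 \<le> T + (6 + n)"
    "R1 c = k" "R1 (c + 1) = n - k" "Inv (n - k) R1 M1"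
    by (elim runsE) auto
  with Suc.IH[of R1 M1] Suc.prems(1) obtain t2 s2
    where rest: "exec (While c (Seq B (count_step c))) (R1, M1) t2 s2"
      "t2 \<le> 1 + k * (T + 2 * n + 7)" "case_prod (Inv n) s2"
    by (auto elim: runsE)
  have "R c \<noteq> 0" using Suc.prems by simp
  from exec.While_True[of R c, OF this first(1) rest(1)] show ?case
    by (rule wpI[OF _ order_refl]) (use first(2) rest(2,3) Suc.prems bits_le[of "R c"] in auto)
qed

lemma runs_for_loop:
  assumes "n \<le> N" "R c = n" "Inv 0 R M"
  shows "runs (for_loop c B) (R, M) (loop_time N T) (\<lambda>(R', M'). Inv n R' M')"
proof -
  have "Inv 0 (R(c + 1 := 0)) M"
    using frame[OF assms(3), of "R (c + 2)" 0 "R c"] by (simp add: fun_upd_twist fun_upd_idem)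
  then have "runs (While c (Seq B (count_step c))) (R(c + 1 := 0), M)
      (1 + n * (T + 2 * n + 7)) (\<lambda>(R', M'). Inv n R' M')"
    using assms(2) by (intro runs_counted_while) auto
  moreover have "1 + (1 + n * (T + 2 * n + 7)) \<le> loop_time N T"
  proof -
    have "n * (T + 2 * n + 7) \<le> N * (T + 2 * N + 7)" using assms(1) by (intro mult_le_mono) auto
    then show ?thesis unfolding loop_time_def by simp
  qed
  ultimately show ?thesis unfolding for_loop_def by (intro wp_Seq wp_Imm) (erule wp_mono, auto)
qed

end

section \<open>Polynomial growth\<close>

definition poly_growth :: "(nat \<Rightarrow> nat) \<Rightarrow> bool" where
  "poly_growth T \<longleftrightarrow> (\<exists>K. \<forall>V. T V \<le> (V + 2) ^ K)"

lemma poly_growth_const: "poly_growth (\<lambda>_. c)"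
proof -
  have "c \<le> (V + 2) ^ c" for V :: nat
    using less_exp[of c] power_mono[of 2 "V + 2" c] by simp
  then show ?thesis unfolding poly_growth_def by blast
qed

lemma poly_growth_id: "poly_growth (\<lambda>V. V)"
  unfolding poly_growth_def by (rule exI[of _ 1]) simp

lemma poly_growth_mult:
  assumes "poly_growth S" "poly_growth T" shows "poly_growth (\<lambda>V. S V * T V)"
proof -
  from assms obtain K K' where "\<forall>V. S V \<le> (V + 2) ^ K" "\<forall>V. T V \<le> (V + 2) ^ K'"
    unfolding poly_growth_def by blast
  then have "S V * T V \<le> (V + 2) ^ (K + K')" for V
    by (simp add: power_add mult_le_mono)
  then show ?thesis unfolding poly_growth_def by blast
qed

lemma poly_growth_add:
  assumes "poly_growth S" "poly_growth T" shows "poly_growth (\<lambda>V. S V + T V)"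
proof -
  from assms obtain K K' where K: "\<forall>V. S V \<le> (V + 2) ^ K" "\<forall>V. T V \<le> (V + 2) ^ K'"
    unfolding poly_growth_def by blast
  have "S V + T V \<le> (V + 2) ^ (K + K' + 1)" for V
  proof -
    have "S V \<le> (V + 2) ^ (K + K')" "T V \<le> (V + 2) ^ (K + K')"
      using K power_increasing[of K "K + K'" "V + 2"] power_increasing[of K' "K + K'" "V + 2"]
      by (meson le_add1 le_add2 le_trans one_le_numeral trans_le_add2)+
    then have "S V + T V \<le> 2 * (V + 2) ^ (K + K')" by simp
    also have "\<dots> \<le> (V + 2) * (V + 2) ^ (K + K')" by (rule mult_le_mono1) simp
    finally show ?thesis by simp
  qed
  then show ?thesis unfolding poly_growth_def by blast
qed

lemma poly_growth_compose:
  assumes "poly_growth S" "poly_growth T" shows "poly_growth (\<lambda>V. S (T V))"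
proof -
  from assms(1) obtain K where K: "\<forall>V. S V \<le> (V + 2) ^ K"
    unfolding poly_growth_def by blast
  from poly_growth_add[OF assms(2) poly_growth_const[of 2]] obtain K'
    where K': "\<forall>V. T V + 2 \<le> (V + 2) ^ K'"
    unfolding poly_growth_def by blast
  have "S (T V) \<le> (V + 2) ^ (K' * K)" for V
    using K K' power_mono[of "T V + 2" "(V + 2) ^ K'" K]
    by (metis le_trans power_mult zero_le)
  then show ?thesis unfolding poly_growth_def by blast
qed

lemmas poly_growth_intros =
  poly_growth_const poly_growth_id poly_growth_add poly_growth_mult

lemma poly_growth_loop_time:
  assumes "poly_growth S" "poly_growth T" shows "poly_growth (\<lambda>V. loop_time (S V) (T V))"
  unfolding loop_time_def by (intro poly_growth_intros assms)

section \<open>Polynomial-time functions of the input word\<close>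

definition fits :: "nat list \<Rightarrow> nat \<Rightarrow> bool" where
  "fits xs V \<longleftrightarrow> length xs \<le> V \<and> (\<forall>x \<in> set xs. x \<le> V)"

text \<open>
  An abstract argument \<open>a\<close> determines the input word \<open>I a\<close> and the values \<open>g a\<close> of the variables \<open>g \<in> G\<close>.
  In \<open>ready I G \<rho> a V s\<close>, the variable \<open>g\<close> is held by register \<open>\<rho> g\<close>. Since only the cells below
  \<open>length (I a)\<close> are constrained, programs also run while output is being written behind the input. They leave
  their result in register \<open>d\<close> and use the registers from \<open>d\<close> up to \<open>D - 1\<close> as scratch space.
\<close>

definition inputs_le :: "('a \<Rightarrow> nat list) \<Rightarrow> ('a \<Rightarrow> nat) set \<Rightarrow> 'a \<Rightarrow> nat \<Rightarrow> bool" where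
  "inputs_le I G a V \<longleftrightarrow> fits (I a) V \<and> (\<forall>g \<in> G. g a \<le> V)"

definition ready ::
    "('a \<Rightarrow> nat list) \<Rightarrow> ('a \<Rightarrow> nat) set \<Rightarrow> (('a \<Rightarrow> nat) \<Rightarrow> nat) \<Rightarrow> 'a \<Rightarrow> nat \<Rightarrow> state \<Rightarrow> bool" where
  "ready I G \<rho> a V s \<longleftrightarrow> inputs_le I G a V \<and> fst s 0 = length (I a) \<and>
     (\<forall>j < length (I a). snd s j = I a ! j) \<and> (\<forall>g \<in> G. fst s (\<rho> g) = g a)"

definition layout :: "('a \<Rightarrow> nat) set \<Rightarrow> (('a \<Rightarrow> nat) \<Rightarrow> nat) \<Rightarrow> nat \<Rightarrow> bool" where
  "layout G \<rho> d \<longleftrightarrow> 0 < d \<and> (\<forall>g \<in> G. \<rho> g < d)"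

definition yields :: "nat \<Rightarrow> nat \<Rightarrow> nat \<Rightarrow> state \<Rightarrow> state \<Rightarrow> bool" where
  "yields d D v s s' \<longleftrightarrow> snd s' = snd s \<and> fst s' d = v \<and> (\<forall>x. x < d \<or> D \<le> x \<longrightarrow> fst s' x = fst s x)"

definition computes :: "com \<Rightarrow> nat \<Rightarrow> (nat \<Rightarrow> nat) \<Rightarrow> ('a \<Rightarrow> nat list) \<Rightarrow> ('a \<Rightarrow> nat) set \<Rightarrow>
    (('a \<Rightarrow> nat) \<Rightarrow> nat) \<Rightarrow> nat \<Rightarrow> ('a \<Rightarrow> nat) \<Rightarrow> bool" where
  "computes P D T I G \<rho> d f \<longleftrightarrow>
     (\<forall>a s V. ready I G \<rho> a V s \<longrightarrow> runs P s (T V) (yields d D (f a) s))"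

definition poly_bounded :: "('a \<Rightarrow> nat list) \<Rightarrow> ('a \<Rightarrow> nat) set \<Rightarrow> ('a \<Rightarrow> nat) \<Rightarrow> bool" where
  "poly_bounded I G f \<longleftrightarrow> (\<exists>B. poly_growth B \<and> (\<forall>a V. inputs_le I G a V \<longrightarrow> f a \<le> B V))"

text \<open>
  \<open>polytime I G f\<close> means that \<open>f\<close> is computable in time polynomial in the input length, the largest input entry
  and the variables in \<open>G\<close>. Quantifying over all layouts makes this notion stable under composition.
\<close>

definition polytime :: "('a \<Rightarrow> nat list) \<Rightarrow> ('a \<Rightarrow> nat) set \<Rightarrow> ('a \<Rightarrow> nat) \<Rightarrow> bool" where
  "polytime I G f \<longleftrightarrow> poly_bounded I G f \<and>
     (\<forall>\<rho> d. layout G \<rho> d \<longrightarrow> (\<exists>P D T. poly_growth T \<and> computes P D T I G \<rho> d f))"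

abbreviation polytime_pred :: "('a \<Rightarrow> nat list) \<Rightarrow> ('a \<Rightarrow> nat) set \<Rightarrow> ('a \<Rightarrow> bool) \<Rightarrow> bool" where
  "polytime_pred I G Q \<equiv> polytime I G (\<lambda>a. of_bool (Q a))"

lemma fits_mono: "fits xs V \<Longrightarrow> V \<le> V' \<Longrightarrow> fits xs V'"
  unfolding fits_def by (meson le_trans)

lemma inputs_le_mono: "inputs_le I G a V \<Longrightarrow> V \<le> V' \<Longrightarrow> inputs_le I G a V'"
  unfolding inputs_le_def using fits_mono by (meson le_trans)

lemma ready_inputs_le: "ready I G \<rho> a V s \<Longrightarrow> inputs_le I G a V"
  unfolding ready_def by blast

lemma ready_mono: "ready I G \<rho> a V s \<Longrightarrow> V \<le> V' \<Longrightarrow> ready I G \<rho> a V' s"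
  unfolding ready_def by (blast intro: inputs_le_mono)

lemma ready_cong:
  "ready I G \<rho> a V (R, M) \<Longrightarrow> layout G \<rho> d \<Longrightarrow> (\<And>x. x < d \<Longrightarrow> R' x = R x) \<Longrightarrow> ready I G \<rho> a V (R', M)"
  unfolding ready_def layout_def by simp

lemma layout_mono: "layout G \<rho> d \<Longrightarrow> d \<le> d' \<Longrightarrow> layout G \<rho> d'"
  unfolding layout_def by fastforce

lemma poly_boundedI:
  "poly_growth B \<Longrightarrow> (\<And>a V. inputs_le I G a V \<Longrightarrow> f a \<le> B V) \<Longrightarrow> poly_bounded I G f"
  unfolding poly_bounded_def by blast

lemma polytime_poly_bounded: "polytime I G f \<Longrightarrow> poly_bounded I G f"
  unfolding polytime_def by blast

lemma poly_boundedE: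
  assumes "poly_bounded I G f"
  obtains B where "poly_growth B" "\<And>a V. inputs_le I G a V \<Longrightarrow> f a \<le> B V"
  using assms unfolding poly_bounded_def by blast

lemma polytimeI:
  assumes "poly_bounded I G f"
    and "\<And>\<rho> d. layout G \<rho> d \<Longrightarrow> \<exists>P D T. poly_growth T \<and> computes P D T I G \<rho> d f"
  shows "polytime I G f"
  using assms unfolding polytime_def by blast

lemma polytimeE:
  assumes "polytime I G f" "layout G \<rho> d"
  obtains P D T where "poly_growth T" "computes P D T I G \<rho> d f"
  using assms unfolding polytime_def by blast

lemma computesI:
  assumes "\<And>a R M V. ready I G \<rho> a V (R, M) \<Longrightarrow> runs P (R, M) (T V) (yields d D (f a) (R, M))"
  shows "computes P D T I G \<rho> d f"
  using assms unfolding computes_def split_paired_All by blast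

lemma runs_computes:
  assumes "computes P D T I G \<rho> d f" "ready I G \<rho> a V (R, M)"
    and "\<And>R'. R' d = f a \<Longrightarrow> (\<And>x. x < d \<or> D \<le> x \<Longrightarrow> R' x = R x) \<Longrightarrow> Q (R', M)"
  shows "runs P (R, M) (T V) Q"
proof (rule runs_mono[OF _ order_refl])
  show "runs P (R, M) (T V) (yields d D (f a) (R, M))" using assms(1,2) unfolding computes_def by blast
  show "Q s" if "yields d D (f a) (R, M) s" for s
    using that assms(3)[of "fst s"] unfolding yields_def by (metis fst_conv prod.collapse snd_conv)
qed

lemma runs_Seq_computes:
  assumes "computes P D T I G \<rho> d f" "ready I G \<rho> a V (R, M)"
    and "\<And>R'. R' d = f a \<Longrightarrow> (\<And>x. x < d \<or> D \<le> x \<Longrightarrow> R' x = R x) \<Longrightarrow> runs P' (R', M) T' Q"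
  shows "runs (Seq P P') (R, M) (T V + T') Q"
proof (rule runs_Seq)
  show "runs P (R, M) (T V) (\<lambda>s. runs P' s T' Q)" by (rule runs_computes[OF assms(1,2)], rule assms(3))
qed

lemma polytime_cong: "(\<And>a. f a = g a) \<Longrightarrow> polytime I G f \<Longrightarrow> polytime I G g"
  by presburger

lemma polytime_by_program:
  assumes "poly_bounded I G f" "poly_growth T" "\<And>\<rho> d. layout G \<rho> d \<Longrightarrow> computes (P \<rho> d) (D d) T I G \<rho> d f"
  shows "polytime I G f"
  by (rule polytimeI[OF assms(1)]) (use assms(2,3) in blast)

lemma polytime_const: "polytime I G (\<lambda>_. c)"
proof (rule polytime_by_program)
  show "computes (Imm d c) (Suc d) (\<lambda>_. 1 + c) I G \<rho> d (\<lambda>_. c)" for \<rho> d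
    by (rule computesI, rule wp_Imm) (simp add: yields_def)
qed (rule poly_boundedI[OF poly_growth_const order_refl] poly_growth_const)+

lemma polytime_var:
  assumes "g \<in> G" shows "polytime I G g"
proof (rule polytime_by_program)
  show "poly_bounded I G g"
    by (rule poly_boundedI[OF poly_growth_id]) (use assms in \<open>simp add: inputs_le_def\<close>)
  show "computes (copy d (\<rho> g)) (Suc d) (\<lambda>V. 2 + V) I G \<rho> d g" if "layout G \<rho> d" for \<rho> d
    by (rule computesI, rule wp_copy)
      (use assms that in \<open>auto simp: ready_def layout_def inputs_le_def yields_def\<close>)
qed (intro poly_growth_intros)

lemma polytime_instruction:
  assumes vars: "u \<in> G" "v \<in> G" and bound: "\<And>x y. h x y \<le> x + y"
    and instr: "\<And>d x y R M Q. Q (1 + R x + R y) (R(d := h (R x) (R y)), M) \<Longrightarrow> wp (instr d x y) (R, M) Q"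
  shows "polytime I G (\<lambda>a. h (u a) (v a))"
proof (rule polytime_by_program)
  show "poly_bounded I G (\<lambda>a. h (u a) (v a))"
  proof (rule poly_boundedI)
    show "h (u a) (v a) \<le> V + V" if "inputs_le I G a V" for a V
      using that vars bound[of "u a" "v a"] unfolding inputs_le_def by (meson add_mono le_trans)
  qed (intro poly_growth_intros)
  show "computes (instr d (\<rho> u) (\<rho> v)) (Suc d) (\<lambda>V. 1 + V + V) I G \<rho> d (\<lambda>a. h (u a) (v a))" for \<rho> d
    by (rule computesI, rule instr)
      (use vars in \<open>auto simp: ready_def inputs_le_def yields_def intro!: add_mono\<close>)
qed (intro poly_growth_intros)

definition cell :: "nat list \<Rightarrow> nat \<Rightarrow> nat" where
  "cell xs j = (if j < length xs then xs ! j else 0)"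

lemma cell_le: "fits xs V \<Longrightarrow> cell xs j \<le> V"
  unfolding cell_def fits_def by simp

lemma polytime_cell_var:
  assumes u: "u \<in> G" shows "polytime I G (\<lambda>a. cell (I a) (u a))"
proof (rule polytime_by_program)
  show "poly_bounded I G (\<lambda>a. cell (I a) (u a))"
    by (rule poly_boundedI[OF poly_growth_id]) (simp add: inputs_le_def cell_le)
  let ?P = "\<lambda>\<rho> d. Seq (Sub d 0 (\<rho> u)) (Cond d (Load d (\<rho> u)) (Imm d 0))"
  show "computes (?P \<rho> d) (Suc d) (\<lambda>V. 3 + 5 * V) I G \<rho> d (\<lambda>a. cell (I a) (u a))" if layout: "layout G \<rho> d" for \<rho> d
  proof (rule computesI)
    fix a R M V assume ready: "ready I G \<rho> a V (R, M)"
    then have "\<rho> u \<noteq> d" "R 0 = length (I a)" "length (I a) \<le> V" "R (\<rho> u) = u a" "u a \<le> V"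
      using u layout unfolding ready_def layout_def inputs_le_def fits_def by auto
    moreover have "cell (I a) (u a) \<le> V"
      using ready unfolding ready_def inputs_le_def by (simp add: cell_le)
    moreover have "if u a < length (I a) then M (u a) = cell (I a) (u a) else cell (I a) (u a) = 0"
      using ready unfolding ready_def cell_def by simp
    ultimately show "runs (?P \<rho> d) (R, M) (3 + 5 * V) (yields d (Suc d) (cell (I a) (u a)) (R, M))"
      by (intro wp_intros) (auto simp: yields_def split: if_splits)
  qed
qed (intro poly_growth_intros)

lemma polytime_if_var:
  assumes vars: "c \<in> G" "u \<in> G" "v \<in> G"
  shows "polytime I G (\<lambda>a. if c a \<noteq> 0 then u a else v a)"
proof (rule polytime_by_program)
  show "poly_bounded I G (\<lambda>a. if c a \<noteq> 0 then u a else v a)"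
    by (rule poly_boundedI[OF poly_growth_id]) (use vars in \<open>simp add: inputs_le_def\<close>)
  show "computes (Cond (\<rho> c) (copy d (\<rho> u)) (copy d (\<rho> v))) (Suc d) (\<lambda>V. 3 + 2 * V) I G \<rho> d
      (\<lambda>a. if c a \<noteq> 0 then u a else v a)" if layout: "layout G \<rho> d" for \<rho> d
  proof (rule computesI)
    fix a R M V assume "ready I G \<rho> a V (R, M)"
    then have "R (\<rho> c) = c a" "R (\<rho> u) = u a" "R (\<rho> v) = v a" "c a \<le> V" "u a \<le> V" "v a \<le> V"
      using vars unfolding ready_def inputs_le_def by auto
    moreover have "\<rho> u \<noteq> d" "\<rho> v \<noteq> d" using layout vars unfolding layout_def by auto
    ultimately show "runs (Cond (\<rho> c) (copy d (\<rho> u)) (copy d (\<rho> v))) (R, M) (3 + 2 * V)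
        (yields d (Suc d) (if c a \<noteq> 0 then u a else v a) (R, M))"
      by (intro wp_Cond wp_copy) (simp_all add: yields_def)
  qed
qed (intro poly_growth_intros)

section \<open>Composition and recursion\<close>

definition with_index :: "('a \<Rightarrow> nat) set \<Rightarrow> ('a \<times> nat \<Rightarrow> nat) set" where
  "with_index G = insert snd ((\<lambda>g p. g (fst p)) ` G)"

text \<open>
  Apart from \<open>snd\<close>, the variables in \<open>with_index G\<close> ignore the index. Evaluating them at index 0 recovers the
  variables in \<open>G\<close>.
\<close>

definition push :: "nat \<Rightarrow> (('a \<Rightarrow> nat) \<Rightarrow> nat) \<Rightarrow> ('a \<times> nat \<Rightarrow> nat) \<Rightarrow> nat" where
  "push x \<rho> g = (if g = snd then x else \<rho> (\<lambda>a. g (a, 0)))"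

lemma push_simps: "push x \<rho> snd = x" "push x \<rho> (\<lambda>p. g (fst p)) = \<rho> g"
proof -
  have "(\<lambda>p :: 'a \<times> nat. g (fst p)) \<noteq> snd"
  proof
    assume "(\<lambda>p. g (fst p)) = (snd :: 'a \<times> nat \<Rightarrow> nat)"
    from fun_cong[OF this, of "(undefined, 0)"] fun_cong[OF this, of "(undefined, 1)"] show False by simp
  qed
  then show "push x \<rho> snd = x" "push x \<rho> (\<lambda>p. g (fst p)) = \<rho> g"
    unfolding push_def by simp_all
qed

lemma inputs_le_with_index:
  "inputs_le (\<lambda>p. I (fst p)) (with_index G) (a, v) V \<longleftrightarrow> inputs_le I G a V \<and> v \<le> V"
  unfolding inputs_le_def with_index_def by auto

lemma ready_push:
  assumes "ready I G \<rho> a V (R, M)" "R x = v" "v \<le> V"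
  shows "ready (\<lambda>p. I (fst p)) (with_index G) (push x \<rho>) (a, v) V (R, M)"
  using assms unfolding ready_def inputs_le_with_index by (auto simp: with_index_def push_simps)

lemma layout_push: "layout G \<rho> d \<Longrightarrow> x < d \<Longrightarrow> layout (with_index G) (push x \<rho>) d"
  unfolding layout_def with_index_def by (auto simp: push_simps)

lemma polytime_bound_var: "polytime I (with_index G) snd"
  by (rule polytime_var) (simp add: with_index_def)

lemma polytime_lift:
  assumes f: "polytime I G f" shows "polytime (\<lambda>p. I (fst p)) (with_index G) (\<lambda>p. f (fst p))"
proof (rule polytimeI)
  from polytime_poly_bounded[OF f] show "poly_bounded (\<lambda>p. I (fst p)) (with_index G) (\<lambda>p. f (fst p))"
    unfolding poly_bounded_def by (auto simp: inputs_le_with_index)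
  fix \<rho> :: "('a \<times> nat \<Rightarrow> nat) \<Rightarrow> nat" and d
  let ?\<rho> = "\<lambda>g. \<rho> (\<lambda>p. g (fst p))"
  assume "layout (with_index G) \<rho> d"
  then have "layout G ?\<rho> d" unfolding layout_def with_index_def by simp
  from polytimeE[OF f this] obtain P D T where P: "poly_growth T" "computes P D T I G ?\<rho> d f" .
  have "ready I G ?\<rho> (fst p) V s" if "ready (\<lambda>p. I (fst p)) (with_index G) \<rho> p V s" for p V s
    using that unfolding ready_def inputs_le_def with_index_def by simp
  with P(2) have "computes P D T (\<lambda>p. I (fst p)) (with_index G) \<rho> d (\<lambda>p. f (fst p))"
    unfolding computes_def by (intro allI impI) auto
  with P(1) show "\<exists>P D T. poly_growth T \<and> computes P D T (\<lambda>p. I (fst p)) (with_index G) \<rho> d (\<lambda>p. f (fst p))"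
    by blast
qed

lemma computes_let:
  assumes Pf: "computes Pf Df Tf I G \<rho> d f"
    and Pg: "computes Pg Dg Tg (\<lambda>p. I (fst p)) (with_index G) (push d \<rho>) (Suc d) (\<lambda>p. g (fst p) (snd p))"
    and layout: "layout G \<rho> d"
    and Bf: "\<And>a V. inputs_le I G a V \<Longrightarrow> f a \<le> Bf V" and Bg: "\<And>a V. inputs_le I G a V \<Longrightarrow> g a (f a) \<le> Bg V"
  shows "computes (Seq Pf (Seq Pg (copy d (Suc d)))) (Df + Dg + d + 2)
    (\<lambda>V. Tf V + (Tg (V + Bf V) + (2 + Bg V))) I G \<rho> d (\<lambda>a. g a (f a))"
proof (rule computesI, rule runs_Seq_computes[OF Pf], assumption)
  fix a R M V R1
  assume ready: "ready I G \<rho> a V (R, M)" and R1: "R1 d = f a" "\<And>x. x < d \<or> Df \<le> x \<Longrightarrow> R1 x = R x"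
  have "ready I G \<rho> a (V + Bf V) (R1, M)"
    by (rule ready_mono[OF ready_cong[OF ready layout]]) (use R1 in auto)
  moreover have "f a \<le> V + Bf V" using Bf[OF ready_inputs_le[OF ready]] by simp
  ultimately have ready1: "ready (\<lambda>p. I (fst p)) (with_index G) (push d \<rho>) (a, f a) (V + Bf V) (R1, M)"
    using R1(1) by (intro ready_push)
  show "runs (Seq Pg (copy d (Suc d))) (R1, M) (Tg (V + Bf V) + (2 + Bg V))
      (yields d (Df + Dg + d + 2) (g a (f a)) (R, M))"
  proof (rule runs_Seq_computes[OF Pg ready1])
    fix R2 assume "R2 (Suc d) = g (fst (a, f a)) (snd (a, f a))" "\<And>x. x < Suc d \<or> Dg \<le> x \<Longrightarrow> R2 x = R1 x"
    then show "runs (copy d (Suc d)) (R2, M) (2 + Bg V) (yields d (Df + Dg + d + 2) (g a (f a)) (R, M))"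
      using R1(2) Bg[OF ready_inputs_le[OF ready]] by (intro wp_copy) (simp_all add: yields_def)
  qed
qed

lemma polytime_let:
  assumes f: "polytime I G f"
    and g: "polytime (\<lambda>p. I (fst p)) (with_index G) (\<lambda>p. g (fst p) (snd p))"
  shows "polytime I G (\<lambda>a. g a (f a))"
proof -
  obtain Bf where Bf: "poly_growth Bf" "\<And>a V. inputs_le I G a V \<Longrightarrow> f a \<le> Bf V"
    using polytime_poly_bounded[OF f] by (elim poly_boundedE) blast
  obtain Bg where Bg: "poly_growth Bg"
    "\<And>p V. inputs_le (\<lambda>p. I (fst p)) (with_index G) p V \<Longrightarrow> g (fst p) (snd p) \<le> Bg V"
    using polytime_poly_bounded[OF g] by (elim poly_boundedE) blast
  have growth: "poly_growth (\<lambda>V. S (V + Bf V))" if "poly_growth S" for S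
    by (intro poly_growth_compose[OF that] poly_growth_intros Bf)
  have bound: "g a (f a) \<le> Bg (V + Bf V)" if "inputs_le I G a V" for a V
    using Bg(2)[of "(a, f a)" "V + Bf V"] Bf(2)[OF that] inputs_le_mono[OF that, of "V + Bf V"]
    by (simp add: inputs_le_with_index)
  show ?thesis
  proof (rule polytimeI)
    show "poly_bounded I G (\<lambda>a. g a (f a))" by (rule poly_boundedI[OF growth[OF Bg(1)] bound])
    fix \<rho> d assume layout: "layout G \<rho> d"
    from polytimeE[OF f layout] obtain Pf Df Tf where Pf: "poly_growth Tf" "computes Pf Df Tf I G \<rho> d f" .
    have "layout (with_index G) (push d \<rho>) (Suc d)" by (rule layout_push[OF layout_mono[OF layout]]) simp_all
    from polytimeE[OF g this] obtain Pg Dg Tg where Pg: "poly_growth Tg"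
      "computes Pg Dg Tg (\<lambda>p. I (fst p)) (with_index G) (push d \<rho>) (Suc d) (\<lambda>p. g (fst p) (snd p))" .
    have "computes (Seq Pf (Seq Pg (copy d (Suc d)))) (Df + Dg + d + 2)
        (\<lambda>V. Tf V + (Tg (V + Bf V) + (2 + Bg (V + Bf V)))) I G \<rho> d (\<lambda>a. g a (f a))"
      by (rule computes_let[OF Pf(2) Pg(2) layout Bf(2) bound])
    moreover have "poly_growth (\<lambda>V. Tf V + (Tg (V + Bf V) + (2 + Bg (V + Bf V))))"
      by (intro poly_growth_add poly_growth_const Pf(1) growth[OF Pg(1)] growth[OF Bg(1)])
    ultimately show "\<exists>P D T. poly_growth T \<and> computes P D T I G \<rho> d (\<lambda>a. g a (f a))" by blast
  qed
qed

lemma polytime_let2: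
  assumes f: "polytime I G f" and g: "polytime I G g"
    and h: "polytime (\<lambda>p. I (fst (fst p))) (with_index (with_index G)) (\<lambda>p. h (fst (fst p)) (snd (fst p)) (snd p))"
  shows "polytime I G (\<lambda>a. h a (f a) (g a))"
  by (rule polytime_let[OF f polytime_let[OF polytime_lift[OF g] h]])

lemma polytime_add:
  assumes "polytime I G f" "polytime I G g" shows "polytime I G (\<lambda>a. f a + g a)"
  by (rule polytime_let2[OF assms], rule polytime_instruction[where instr = Add])
    (auto simp: with_index_def intro: wp_Add)

lemma polytime_diff:
  assumes "polytime I G f" "polytime I G g" shows "polytime I G (\<lambda>a. f a - g a)"
  by (rule polytime_let2[OF assms], rule polytime_instruction[where instr = Sub])
    (auto simp: with_index_def intro: wp_Sub)

lemma polytime_cell: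
  assumes "polytime I G f" shows "polytime I G (\<lambda>a. cell (I a) (f a))"
  by (rule polytime_let[OF assms], rule polytime_cell_var) (simp add: with_index_def)

lemma polytime_if_nonzero:
  assumes "polytime I G c" "polytime I G f" "polytime I G g"
  shows "polytime I G (\<lambda>a. if c a \<noteq> 0 then f a else g a)"
  by (rule polytime_let[OF assms(1)], rule polytime_let2[OF assms(2,3)[THEN polytime_lift]], rule polytime_if_var)
    (simp_all add: with_index_def)

lemma runs_rec_loop:
  assumes step: "computes P D T (\<lambda>p. I (fst (fst p))) (with_index (with_index G)) (push d (push (d + 2) \<rho>)) (d + 4)
      (\<lambda>p. h (fst (fst p)) (snd (fst p)) (snd p))"
    and layout: "layout G \<rho> d" and ready: "ready I G \<rho> a V (R, M)"
    and bound: "n \<le> V" "\<And>i. i \<le> n \<Longrightarrow> rec_nat z (h a) i \<le> V"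
    and R: "R d = z" "R (d + 1) = n"
  shows "runs (for_loop (d + 1) (Seq P (copy d (d + 4)))) (R, M) (loop_time V (T V + (2 + V)))
    (yields d (D + d + 5) (rec_nat z (h a) n) (R, M))"
proof -
  let ?F = "rec_nat z (h a)"
  define Inv where "Inv i R' M' \<longleftrightarrow> M' = M \<and> R' d = ?F i \<and> (\<forall>x. x < d \<or> D + d + 5 \<le> x \<longrightarrow> R' x = R x)" for i R' M'
  have "runs (for_loop (d + 1) (Seq P (copy d (d + 4)))) (R, M) (loop_time V (T V + (2 + V))) (\<lambda>(R', M'). Inv n R' M')"
  proof (rule runs_for_loop)
    fix i R' M'
    assume i: "i < n" and Inv: "Inv i R' M'" and R': "R' (d + 1) = n - i" "R' (d + 1 + 1) = i"
    have M: "M' = M" using Inv unfolding Inv_def by blast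
    have "ready I G \<rho> a V (R', M)" by (rule ready_cong[OF ready layout]) (use Inv in \<open>simp add: Inv_def\<close>)
    then have "ready (\<lambda>p. I (fst p)) (with_index G) (push (d + 2) \<rho>) (a, i) V (R', M)"
      by (rule ready_push) (use R' i bound in auto)
    then have "ready (\<lambda>p. I (fst (fst p))) (with_index (with_index G)) (push d (push (d + 2) \<rho>))
        ((a, i), ?F i) V (R', M)"
      by (rule ready_push) (use Inv i bound in \<open>auto simp: Inv_def\<close>)
    then show "runs (Seq P (copy d (d + 4))) (R', M') (T V + (2 + V))
        (\<lambda>(R'', M''). R'' (d + 1) = n - i \<and> R'' (d + 1 + 1) = i \<and> Inv (Suc i) R'' M'')"
      unfolding M
    proof (rule runs_Seq_computes[OF step])
      fix R2 assume R2: "R2 (d + 4) = h (fst (fst ((a, i), ?F i))) (snd (fst ((a, i), ?F i))) (snd ((a, i), ?F i))"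
        "\<And>x. x < d + 4 \<or> D \<le> x \<Longrightarrow> R2 x = R' x"
      then have "R2 (d + 4) = ?F (Suc i)" by simp
      moreover have "?F (Suc i) \<le> V" using bound(2)[of "Suc i"] i by simp
      ultimately show "runs (copy d (d + 4)) (R2, M) (2 + V)
          (\<lambda>(R'', M''). R'' (d + 1) = n - i \<and> R'' (d + 1 + 1) = i \<and> Inv (Suc i) R'' M'')"
        using R2(2) R' Inv by (intro wp_copy) (simp_all add: Inv_def del: old.nat.simps)
    qed
  qed (use bound(1) R in \<open>auto simp: Inv_def\<close>)
  then show ?thesis by (rule runs_mono) (auto simp: Inv_def yields_def)
qed

lemma computes_rec:
  assumes Pz: "computes Pz Dz Tz I G \<rho> d z"
    and Pn: "computes Pn Dn Tn I G \<rho> (d + 1) n"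
    and step: "computes P D T (\<lambda>p. I (fst (fst p))) (with_index (with_index G)) (push d (push (d + 2) \<rho>)) (d + 4)
      (\<lambda>p. h (fst (fst p)) (snd (fst p)) (snd p))"
    and layout: "layout G \<rho> d"
    and bound: "\<And>a V. inputs_le I G a V \<Longrightarrow> V \<le> W V \<and> n a \<le> W V \<and> (\<forall>i \<le> n a. rec_nat (z a) (h a) i \<le> W V)"
  shows "computes (Seq Pz (Seq Pn (for_loop (d + 1) (Seq P (copy d (d + 4)))))) (Dz + Dn + D + d + 5)
    (\<lambda>V. Tz V + (Tn V + loop_time (W V) (T (W V) + (2 + W V)))) I G \<rho> d (\<lambda>a. rec_nat (z a) (h a) (n a))"
proof (rule computesI, rule runs_Seq_computes[OF Pz], assumption)
  fix a R M V R1
  assume ready: "ready I G \<rho> a V (R, M)" and R1: "R1 d = z a" "\<And>x. x < d \<or> Dz \<le> x \<Longrightarrow> R1 x = R x"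
  have ready1: "ready I G \<rho> a V (R1, M)" by (rule ready_cong[OF ready layout]) (use R1 in auto)
  show "runs (Seq Pn (for_loop (d + 1) (Seq P (copy d (d + 4))))) (R1, M)
      (Tn V + loop_time (W V) (T (W V) + (2 + W V)))
      (yields d (Dz + Dn + D + d + 5) (rec_nat (z a) (h a) (n a)) (R, M))"
  proof (rule runs_Seq_computes[OF Pn ready1])
    fix R2 assume R2: "R2 (d + 1) = n a" "\<And>x. x < d + 1 \<or> Dn \<le> x \<Longrightarrow> R2 x = R1 x"
    have bounds: "V \<le> W V" "n a \<le> W V" "\<And>i. i \<le> n a \<Longrightarrow> rec_nat (z a) (h a) i \<le> W V"
      using bound[OF ready_inputs_le[OF ready]] by blast+
    have "ready I G \<rho> a (W V) (R2, M)"
      by (rule ready_mono[OF ready_cong[OF ready1 layout] bounds(1)]) (use R2 in simp)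
    from runs_rec_loop[OF step layout this bounds(2,3) _ R2(1)]
    show "runs (for_loop (d + 1) (Seq P (copy d (d + 4)))) (R2, M) (loop_time (W V) (T (W V) + (2 + W V)))
      (yields d (Dz + Dn + D + d + 5) (rec_nat (z a) (h a) (n a)) (R, M))"
      by (rule runs_mono) (use R1 R2 in \<open>simp_all add: yields_def\<close>)
  qed
qed

lemma polytime_rec:
  assumes n: "polytime I G n" and z: "polytime I G z"
    and step: "polytime (\<lambda>p. I (fst (fst p))) (with_index (with_index G)) (\<lambda>p. h (fst (fst p)) (snd (fst p)) (snd p))"
    and bound: "poly_bounded (\<lambda>p. I (fst p)) (with_index G) (\<lambda>p. rec_nat (z (fst p)) (h (fst p)) (snd p))"
  shows "polytime I G (\<lambda>a. rec_nat (z a) (h a) (n a))"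
proof -
  obtain Bn where Bn: "poly_growth Bn" "\<And>a V. inputs_le I G a V \<Longrightarrow> n a \<le> Bn V"
    using polytime_poly_bounded[OF n] by (elim poly_boundedE) blast
  obtain B where B: "poly_growth B" "\<And>p V. inputs_le (\<lambda>p. I (fst p)) (with_index G) p V \<Longrightarrow>
      rec_nat (z (fst p)) (h (fst p)) (snd p) \<le> B V"
    using bound by (elim poly_boundedE) blast
  define W where "W = (\<lambda>V. V + Bn V + B (V + Bn V))"
  have W: "poly_growth W"
    unfolding W_def by (intro poly_growth_intros poly_growth_compose[OF B(1)] Bn(1))
  have W_bound: "V \<le> W V \<and> n a \<le> W V \<and> (\<forall>i \<le> n a. rec_nat (z a) (h a) i \<le> W V)" if "inputs_le I G a V" for a V
  proof -
    have "rec_nat (z a) (h a) i \<le> B (V + Bn V)" if "i \<le> n a" for i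
      using B(2)[of "(a, i)" "V + Bn V"] that Bn(2)[OF \<open>inputs_le I G a V\<close>]
        inputs_le_mono[OF \<open>inputs_le I G a V\<close>, of "V + Bn V"]
      by (simp add: inputs_le_with_index)
    then show ?thesis using Bn(2)[OF that] unfolding W_def by (auto intro: trans_le_add2)
  qed
  show ?thesis
  proof (rule polytimeI)
    show "poly_bounded I G (\<lambda>a. rec_nat (z a) (h a) (n a))" by (rule poly_boundedI[OF W]) (use W_bound in blast)
    fix \<rho> d assume layout: "layout G \<rho> d"
    from polytimeE[OF z layout] obtain Pz Dz Tz where Pz: "poly_growth Tz" "computes Pz Dz Tz I G \<rho> d z" .
    from polytimeE[OF n layout_mono[OF layout]] obtain Pn Dn Tn
      where Pn: "poly_growth Tn" "computes Pn Dn Tn I G \<rho> (d + 1) n" by (metis le_add1)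
    have "layout (with_index (with_index G)) (push d (push (d + 2) \<rho>)) (d + 4)"
      by (intro layout_push layout_mono[OF layout]) simp_all
    from polytimeE[OF step this] obtain P D T where P: "poly_growth T"
      "computes P D T (\<lambda>p. I (fst (fst p))) (with_index (with_index G)) (push d (push (d + 2) \<rho>)) (d + 4)
        (\<lambda>p. h (fst (fst p)) (snd (fst p)) (snd p))" .
    have "poly_growth (\<lambda>V. Tz V + (Tn V + loop_time (W V) (T (W V) + (2 + W V))))"
      by (intro poly_growth_intros poly_growth_loop_time poly_growth_compose[OF P(1)] Pz(1) Pn(1) W)
    moreover note computes_rec[OF Pz(2) Pn(2) P(2) layout W_bound]
    ultimately show "\<exists>P D T. poly_growth T \<and> computes P D T I G \<rho> d (\<lambda>a. rec_nat (z a) (h a) (n a))" by blast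
  qed
qed

lemma polytime_If:
  assumes "polytime_pred I G Q" "polytime I G f" "polytime I G g"
  shows "polytime I G (\<lambda>a. if Q a then f a else g a)"
  by (rule polytime_cong[OF _ polytime_if_nonzero[OF assms]]) simp

lemma polytime_not:
  assumes "polytime_pred I G Q" shows "polytime_pred I G (\<lambda>a. \<not> Q a)"
proof (rule polytime_cong)
  show "polytime I G (\<lambda>a. 1 - of_bool (Q a))" by (intro polytime_diff polytime_const assms)
qed simp

lemma polytime_conj:
  assumes "polytime_pred I G Q" "polytime_pred I G Q'" shows "polytime_pred I G (\<lambda>a. Q a \<and> Q' a)"
proof (rule polytime_cong)
  show "polytime I G (\<lambda>a. if Q a then of_bool (Q' a) else 0)" by (intro polytime_If polytime_const assms)
qed simp

lemma polytime_disj: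
  assumes "polytime_pred I G Q" "polytime_pred I G Q'" shows "polytime_pred I G (\<lambda>a. Q a \<or> Q' a)"
proof (rule polytime_cong)
  show "polytime I G (\<lambda>a. if Q a then 1 else of_bool (Q' a))" by (intro polytime_If polytime_const assms)
qed simp

lemma polytime_iff:
  assumes "polytime_pred I G Q" "polytime_pred I G Q'" shows "polytime_pred I G (\<lambda>a. Q a \<longleftrightarrow> Q' a)"
proof (rule polytime_cong)
  show "polytime I G (\<lambda>a. if Q a then of_bool (Q' a) else of_bool (\<not> Q' a))"
    by (intro polytime_If polytime_not assms)
qed simp

lemma polytime_less:
  assumes "polytime I G f" "polytime I G g" shows "polytime_pred I G (\<lambda>a. f a < g a)"
proof (rule polytime_cong)
  show "polytime I G (\<lambda>a. if g a - f a \<noteq> 0 then 1 else 0)"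
    by (intro polytime_if_nonzero polytime_diff polytime_const assms)
qed simp

lemma polytime_le:
  assumes "polytime I G f" "polytime I G g" shows "polytime_pred I G (\<lambda>a. f a \<le> g a)"
  unfolding not_less[symmetric] by (intro polytime_not polytime_less assms)

lemma polytime_eq:
  assumes "polytime I G f" "polytime I G g" shows "polytime_pred I G (\<lambda>a. f a = g a)"
  unfolding order_eq_iff by (intro polytime_conj polytime_le assms)

lemma polytime_sum:
  assumes n: "polytime I G n" and f: "polytime (\<lambda>p. I (fst p)) (with_index G) (\<lambda>p. f (fst p) (snd p))"
  shows "polytime I G (\<lambda>a. \<Sum>i<n a. f a i)"
proof -
  let ?F = "\<lambda>a. rec_nat 0 (\<lambda>i r. r + f a i)"
  have rec_eq_sum: "?F a m = (\<Sum>i<m. f a i)" for a m by (induction m) simp_all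
  obtain B where B: "poly_growth B"
    "\<And>p V. inputs_le (\<lambda>p. I (fst p)) (with_index G) p V \<Longrightarrow> f (fst p) (snd p) \<le> B V"
    using polytime_poly_bounded[OF f] by (elim poly_boundedE) blast
  have "polytime I G (\<lambda>a. ?F a (n a))"
  proof (rule polytime_rec[OF n polytime_const])
    show "polytime (\<lambda>p. I (fst (fst p))) (with_index (with_index G)) (\<lambda>p. snd p + f (fst (fst p)) (snd (fst p)))"
      by (intro polytime_add polytime_bound_var polytime_lift[OF f])
    show "poly_bounded (\<lambda>p. I (fst p)) (with_index G) (\<lambda>p. ?F (fst p) (snd p))"
    proof (rule poly_boundedI)
      show "poly_growth (\<lambda>V. V * B V)" by (intro poly_growth_intros B)
      fix p V assume V: "inputs_le (\<lambda>p. I (fst p)) (with_index G) p V"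
      obtain a m where p: "p = (a, m)" by (cases p)
      have "f a i \<le> B V" if "i < m" for i
        using B(2)[of "(a, i)" V] V that by (simp add: p inputs_le_with_index)
      then have "(\<Sum>i<m. f a i) \<le> m * B V" using sum_bounded_above[of "{..<m}" "f a" "B V"] by simp
      also have "\<dots> \<le> V * B V" using V by (intro mult_le_mono1) (simp add: p inputs_le_with_index)
      finally show "?F (fst p) (snd p) \<le> V * B V" by (simp add: p rec_eq_sum)
    qed
  qed
  then show ?thesis unfolding rec_eq_sum .
qed

lemma polytime_bounded_ex:
  assumes "polytime I G n" "polytime_pred (\<lambda>p. I (fst p)) (with_index G) (\<lambda>p. Q (fst p) (snd p))"
  shows "polytime_pred I G (\<lambda>a. \<exists>i<n a. Q a i)"
proof (rule polytime_cong)
  show "polytime_pred I G (\<lambda>a. (0 :: nat) < (\<Sum>i<n a. of_bool (Q a i)))"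
    by (intro polytime_less polytime_const polytime_sum assms)
qed (auto simp: sum_eq_0_iff)

lemma polytime_mult:
  assumes "polytime I G f" "polytime I G g" shows "polytime I G (\<lambda>a. f a * g a)"
proof (rule polytime_cong)
  show "polytime I G (\<lambda>a. \<Sum>i<f a. g a)" by (intro polytime_sum assms polytime_lift)
qed simp

lemma div_eq_sum:
  fixes m k :: nat
  assumes "0 < k" shows "m div k = (\<Sum>i<m. of_bool ((i + 1) * k \<le> m))"
proof -
  have "(i + 1) * k \<le> m \<longleftrightarrow> i < m div k" for i
    using less_eq_div_iff_mult_less_eq[OF assms, of "i + 1" m] by (simp add: Suc_le_eq)
  moreover have "{i. i < m \<and> i < m div k} = {..<m div k}" by (auto intro: less_le_trans[OF _ div_le_dividend])
  ultimately show ?thesis by (simp add: of_bool_def sum.If_cases Int_def)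
qed

lemma polytime_div:
  assumes "polytime I G f" "polytime I G g" shows "polytime I G (\<lambda>a. f a div g a)"
proof (rule polytime_cong)
  show "polytime I G (\<lambda>a. if 0 < g a then \<Sum>i<f a. of_bool ((i + 1) * g a \<le> f a) else 0)"
    by (intro polytime_If polytime_less polytime_const polytime_sum polytime_le polytime_mult polytime_add
        polytime_bound_var assms assms[THEN polytime_lift])
qed (simp add: div_eq_sum)

lemma polytime_mod:
  assumes "polytime I G f" "polytime I G g" shows "polytime I G (\<lambda>a. f a mod g a)"
  unfolding minus_div_mult_eq_mod[symmetric] by (intro polytime_diff polytime_mult polytime_div assms)

lemma polytime_finite_cases:
  assumes g: "polytime I G g" and f: "\<And>b. b < B \<Longrightarrow> polytime I G (f b)" and "0 < B"
  shows "polytime I G (\<lambda>a. f (g a mod B) a)"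
proof -
  have "C \<le> B \<Longrightarrow> polytime I G (\<lambda>a. if g a mod B < C then f (g a mod B) a else 0)" for C
  proof (induction C)
    case (Suc C)
    then have "polytime I G (f C)" "polytime I G (\<lambda>a. if g a mod B < C then f (g a mod B) a else 0)"
      using f by simp_all
    from polytime_If[OF polytime_eq[OF polytime_mod[OF g polytime_const] polytime_const] this]
    have "polytime I G (\<lambda>a. if g a mod B = C then f C a else if g a mod B < C then f (g a mod B) a else 0)" .
    then show ?case by (rule polytime_cong[rotated]) (auto simp: less_Suc_eq)
  qed (simp add: polytime_const)
  from this[of B] \<open>0 < B\<close> show ?thesis by simp
qed

section \<open>Polynomial-time reductions\<close>

definition polytime_map :: "(nat list \<Rightarrow> nat list) \<Rightarrow> bool" where
  "polytime_map f \<longleftrightarrow> (\<exists>P T. poly_growth T \<and> (\<forall>xs V. fits xs V \<longrightarrow>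
     runs P (init xs) (T V) (\<lambda>s. s = init (f xs)) \<and> input_size (f xs) \<le> T V))"

lemma init_eq_cell: "init xs = ((\<lambda>r. if r = 0 then length xs else 0), cell xs)"
  unfolding init_def cell_def by simp

lemma input_size_le:
  assumes "fits xs V" shows "input_size xs \<le> V * (1 + V)"
proof -
  have "1 + bits x \<le> 1 + V" if "x \<in> set xs" for x
    using bits_le[of x] assms that unfolding fits_def by fastforce
  then have "input_size xs \<le> length xs * (1 + V)"
    unfolding input_size_def using sum_list_mono[of xs "\<lambda>x. 1 + bits x" "\<lambda>_. 1 + V"] by (simp add: sum_list_triv)
  also have "\<dots> \<le> V * (1 + V)" using assms unfolding fits_def by (intro mult_le_mono1) simp
  finally show ?thesis .
qed

text \<open>
  The output is first written behind the input and then moved down over it, which also erases its old cells since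
  everything behind them is 0. Throughout, register 0 holds the input length and register 1 the output length.
\<close>

definition staged :: "nat \<Rightarrow> nat \<Rightarrow> nat \<Rightarrow> nat list \<Rightarrow> state \<Rightarrow> bool" where
  "staged l n E zs s \<longleftrightarrow> fst s 0 = l \<and> fst s 1 = n \<and> (\<forall>x \<ge> E. fst s x = 0) \<and> snd s = cell zs"

lemma cell_snoc: "(cell xs)(length xs := x) = cell (xs @ [x])"
  by (auto simp: cell_def fun_eq_iff nth_append)

definition append_step :: com where
  "append_step = Seq (Add 4 0 3) (Store 4 5)"

definition write_program :: "com \<Rightarrow> com" where
  "write_program P = Seq (copy 2 1) (for_loop 2 (Seq P append_step))"

lemma runs_write_program:
  assumes P: "computes P D T fst {snd} (\<lambda>_. 3) 5 (\<lambda>p. out (fst p) (snd p))"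
    and V: "fits xs V" "n \<le> V" "\<And>i. i < n \<Longrightarrow> out xs i \<le> V"
    and E: "D + 6 \<le> E" and s: "staged (length xs) n E xs s"
  shows "runs (write_program P) s (2 + n + loop_time V (T V + (2 + 5 * V)))
    (staged (length xs) n E (xs @ map (out xs) [0..<n]))"
proof -
  obtain R where R: "s = (R, cell xs)" "R 0 = length xs" "R 1 = n" "\<And>x. E \<le> x \<Longrightarrow> R x = 0"
    using s unfolding staged_def by (cases s) auto
  define Inv where "Inv i R M \<longleftrightarrow> staged (length xs) n E (xs @ map (out xs) [0..<i]) (R, M)" for i R M
  have "runs (for_loop 2 (Seq P append_step)) (R(2 := n), cell xs)
      (loop_time V (T V + (2 + 5 * V))) (\<lambda>(R', M'). Inv n R' M')"
  proof (rule runs_for_loop)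
    fix i R' M' assume i: "i < n" and Inv: "Inv i R' M'" and counter: "R' 2 = n - i" "R' (2 + 1) = i"
    have l: "length xs \<le> V" using V(1) unfolding fits_def by simp
    have ready: "ready fst {snd} (\<lambda>_. 3) (xs, i) V (R', M')"
      using Inv counter i V unfolding Inv_def staged_def ready_def inputs_le_def
      by (simp add: cell_def nth_append)
    show "runs (Seq P append_step) (R', M') (T V + (2 + 5 * V))
      (\<lambda>(R'', M''). R'' 2 = n - i \<and> R'' (2 + 1) = i \<and> Inv (Suc i) R'' M'')"
    proof (rule runs_Seq_computes[OF P ready])
      fix R2 assume R2: "R2 5 = out (fst (xs, i)) (snd (xs, i))" "\<And>x. x < 5 \<or> D \<le> x \<Longrightarrow> R2 x = R' x"
      have "M'(length xs + i := out xs i) = cell (xs @ map (out xs) [0..<Suc i])"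
        using Inv cell_snoc[of "xs @ map (out xs) [0..<i]"] unfolding Inv_def staged_def by simp
      then show "runs append_step (R2, M') (2 + 5 * V)
          (\<lambda>(R'', M''). R'' 2 = n - i \<and> R'' (2 + 1) = i \<and> Inv (Suc i) R'' M'')"
        unfolding append_step_def using R2 counter i Inv E l V(2) V(3)[OF i]
        by (intro wp_intros) (simp add: Inv_def staged_def)
    qed
  qed (use R E V in \<open>auto simp: Inv_def staged_def\<close>)
  then show ?thesis unfolding write_program_def R(1) Inv_def
    by (intro wp_Seq wp_copy) (use R in \<open>auto elim!: wp_mono\<close>)
qed

definition shift_step :: com where
  "shift_step = Seq (Add 4 0 3) (Seq (Load 5 4) (Store 3 5))"

definition shift_program :: com where
  "shift_program = Seq (Add 2 0 1) (for_loop 2 shift_step)"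

lemma runs_shift_loop:
  assumes V: "l \<le> V" "n \<le> V" "\<And>j. M j \<le> V" and R: "R 0 = l" "R 2 = n"
  shows "runs (for_loop 2 shift_step) (R, M) (loop_time V (3 + 7 * V))
    (\<lambda>(R', M'). (\<forall>x. x < 2 \<or> 6 \<le> x \<longrightarrow> R' x = R x) \<and> M' = (\<lambda>j. if j < n then M (l + j) else M j))"
proof (rule runs_for_loop[where n = n])
  let ?M = "\<lambda>i j. if j < i then M (l + j) else M j"
  fix i R' M'
  assume i: "i < n" and Inv: "(\<forall>x. x < 2 \<or> 6 \<le> x \<longrightarrow> R' x = R x) \<and> M' = ?M i" and counter: "R' 2 = n - i" "R' (2 + 1) = i"
  have "(?M i)(i := M (l + i)) = ?M (Suc i)" by (auto simp: fun_eq_iff)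
  then show "runs shift_step (R', M') (3 + 7 * V)
      (\<lambda>(R', M'). R' 2 = n - i \<and> R' (2 + 1) = i \<and> (\<forall>x. x < 2 \<or> 6 \<le> x \<longrightarrow> R' x = R x) \<and> M' = ?M (Suc i))"
    unfolding shift_step_def using Inv counter i R V(1,2) V(3)[of "l + i"] by (intro wp_intros) simp
qed (use assms in auto)

lemma runs_shift_program:
  assumes V: "length xs + length ys \<le> V" "fits (xs @ ys) V" and E: "6 \<le> E"
    and s: "staged (length xs) (length ys) E (xs @ ys) s"
  shows "runs shift_program s (1 + V + loop_time V (3 + 7 * V)) (staged (length xs) (length ys) E ys)"
proof -
  obtain R where R: "s = (R, cell (xs @ ys))" "R 0 = length xs" "R 1 = length ys" "\<And>x. E \<le> x \<Longrightarrow> R x = 0"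
    using s unfolding staged_def by (cases s) auto
  have "(\<lambda>j. if j < length xs + length ys then cell (xs @ ys) (length xs + j) else cell (xs @ ys) j) = cell ys"
    by (auto simp: cell_def fun_eq_iff nth_append)
  moreover have "runs (for_loop 2 shift_step)
      (R(2 := length xs + length ys), cell (xs @ ys)) (loop_time V (3 + 7 * V))
      (\<lambda>(R', M'). (\<forall>x. x < 2 \<or> 6 \<le> x \<longrightarrow> R' x = (R(2 := length xs + length ys)) x) \<and> M' =
        (\<lambda>j. if j < length xs + length ys then cell (xs @ ys) (length xs + j) else cell (xs @ ys) j))"
    by (rule runs_shift_loop) (use V R cell_le[OF V(2)] in auto)
  ultimately show ?thesis unfolding shift_program_def R(1)
    by (intro wp_Seq wp_Add) (use R V(1) E in \<open>auto simp: staged_def elim!: wp_mono\<close>)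
qed

fun clear_regs :: "nat \<Rightarrow> com" where
  "clear_regs 0 = Imm 1 0"
| "clear_regs (Suc n) = Seq (clear_regs n) (Imm (n + 2) 0)"

lemma runs_clear_regs:
  "runs (clear_regs n) (R, M) (n + 1) (\<lambda>s. s = ((\<lambda>x. if 0 < x \<and> x \<le> n + 1 then 0 else R x), M))"
proof (induction n)
  case 0
  show ?case unfolding clear_regs.simps by (intro wp_Imm) auto
next
  case (Suc n)
  have "runs (Seq (clear_regs n) (Imm (n + 2) 0)) (R, M) (n + 1 + 1)
      (\<lambda>s. s = ((\<lambda>x. if 0 < x \<and> x \<le> Suc n + 1 then 0 else R x), M))"
  proof (rule runs_Seq[OF Suc])
    fix s assume "s = ((\<lambda>x. if 0 < x \<and> x \<le> n + 1 then 0 else R x), M)"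
    then show "runs (Imm (n + 2) 0) s 1 (\<lambda>s. s = ((\<lambda>x. if 0 < x \<and> x \<le> Suc n + 1 then 0 else R x), M))"
      by (auto intro!: wp_Imm)
  qed
  then show ?case by simp
qed

definition clean_up_program :: "nat \<Rightarrow> com" where
  "clean_up_program E = Seq (copy 0 1) (clear_regs E)"

lemma runs_clean_up_program:
  assumes "staged l (length ys) E ys s"
  shows "runs (clean_up_program E) s (2 + length ys + (E + 1)) (\<lambda>s. s = init ys)"
proof -
  obtain R where R: "s = (R, cell ys)" "R 1 = length ys" "\<And>x. E \<le> x \<Longrightarrow> R x = 0"
    using assms unfolding staged_def by (cases s) auto
  show ?thesis unfolding clean_up_program_def R(1)
    by (intro wp_Seq wp_copy wp_mono[OF runs_clear_regs]) (use R in \<open>auto simp: init_eq_cell fun_eq_iff\<close>)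
qed

lemma polytime_output_bound:
  assumes len: "polytime (\<lambda>xs. xs) {} len" and out: "polytime fst {snd} (\<lambda>p. out (fst p) (snd p))"
  obtains W where "poly_growth W"
    "\<And>xs V. fits xs V \<Longrightarrow> V \<le> W V \<and> length xs + len xs \<le> W V \<and> fits (xs @ map (out xs) [0..<len xs]) (W V)"
proof -
  obtain B where B: "poly_growth B" "\<And>xs V. fits xs V \<Longrightarrow> len xs \<le> B V"
    using polytime_poly_bounded[OF len] by (elim poly_boundedE) (auto simp: inputs_le_def)
  obtain B' where B': "poly_growth B'" "\<And>xs i V. fits xs V \<Longrightarrow> i \<le> V \<Longrightarrow> out xs i \<le> B' V"
    using polytime_poly_bounded[OF out] by (elim poly_boundedE) (auto simp: inputs_le_def)
  define W where "W = (\<lambda>V. V + B V + B' (V + B V))"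
  have "fits (xs @ map (out xs) [0..<len xs]) (W V)" if "fits xs V" for xs V
  proof -
    have "out xs i \<le> B' (V + B V)" if "i < len xs" for i
      using that B(2)[OF \<open>fits xs V\<close>] by (intro B'(2) fits_mono[OF \<open>fits xs V\<close>]) auto
    then show ?thesis using that B(2)[OF that] unfolding W_def fits_def
      by (fastforce intro: trans_le_add1 trans_le_add2)
  qed
  moreover have "poly_growth W"
    unfolding W_def by (intro poly_growth_intros poly_growth_compose[OF B'(1)] B(1))
  moreover have "V \<le> W V \<and> length xs + len xs \<le> W V" if "fits xs V" for xs V
    using B(2)[OF that] that unfolding W_def fits_def by simp
  ultimately show ?thesis using that by blast
qed

definition map_program :: "com \<Rightarrow> com \<Rightarrow> nat \<Rightarrow> com" where
  "map_program P1 P2 E = Seq P1 (Seq (write_program P2) (Seq shift_program (clean_up_program E)))"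

definition map_time :: "nat \<Rightarrow> nat \<Rightarrow> nat \<Rightarrow> nat" where
  "map_time V T E = (2 + V + loop_time V (T + (2 + 5 * V))) + ((1 + V + loop_time V (3 + 7 * V)) + (2 + V + (E + 1)))"

lemma runs_map_program:
  assumes P1: "computes P1 D1 T1 (\<lambda>xs. xs) {} (\<lambda>_. 0) 1 len"
    and P2: "computes P2 D2 T2 fst {snd} (\<lambda>_. 3) 5 (\<lambda>p. out (fst p) (snd p))"
    and E: "D1 \<le> E" "D2 + 6 \<le> E" and fits: "fits xs V"
    and W: "V \<le> W" "length xs + len xs \<le> W" "fits (xs @ map (out xs) [0..<len xs]) W"
  shows "runs (map_program P1 P2 E) (init xs) (T1 V + map_time W (T2 W) E)
    (\<lambda>s. s = init (map (out xs) [0..<len xs]))"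
  unfolding map_program_def map_time_def init_eq_cell[of xs]
proof (intro runs_Seq_computes[OF P1] runs_Seq)
  let ?ys = "map (out xs) [0..<len xs]"
  show "ready (\<lambda>xs. xs) {} (\<lambda>_. 0) xs V ((\<lambda>r. if r = 0 then length xs else 0), cell xs)"
    using fits by (simp add: ready_def inputs_le_def cell_def)
  fix R assume "R 1 = len xs" "\<And>x. x < 1 \<or> D1 \<le> x \<Longrightarrow> R x = (if x = 0 then length xs else 0)"
  then have "staged (length xs) (len xs) E xs (R, cell xs)" using E by (simp add: staged_def)
  from runs_write_program[OF P2 fits_mono[OF fits W(1)] _ _ E(2) this]
  show "runs (write_program P2) (R, cell xs) (2 + W + loop_time W (T2 W + (2 + 5 * W)))
      (staged (length xs) (length ?ys) E (xs @ ?ys))"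
    by (rule runs_mono) (use W in \<open>auto simp: fits_def\<close>)
next
  let ?ys = "map (out xs) [0..<len xs]"
  fix s assume "staged (length xs) (length ?ys) E (xs @ ?ys) s"
  from runs_shift_program[OF _ W(3) _ this]
  show "runs shift_program s (1 + W + loop_time W (3 + 7 * W)) (staged (length xs) (length ?ys) E ?ys)"
    using W E by simp
next
  let ?ys = "map (out xs) [0..<len xs]"
  fix s assume "staged (length xs) (length ?ys) E ?ys s"
  from runs_clean_up_program[OF this]
  show "runs (clean_up_program E) s (2 + W + (E + 1)) (\<lambda>s. s = init ?ys)"
    by (rule runs_mono) (use W in simp_all)
qed

theorem polytime_mapI:
  assumes len: "polytime (\<lambda>xs. xs) {} len" and out: "polytime fst {snd} (\<lambda>p. out (fst p) (snd p))"
  shows "polytime_map (\<lambda>xs. map (out xs) [0..<len xs])"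
proof -
  obtain P1 D1 T1 where P1: "poly_growth T1" "computes P1 D1 T1 (\<lambda>xs. xs) {} (\<lambda>_. 0) 1 len"
    by (rule polytimeE[OF len, of "\<lambda>_. 0" 1]) (simp add: layout_def)
  obtain P2 D2 T2 where P2: "poly_growth T2" "computes P2 D2 T2 fst {snd} (\<lambda>_. 3) 5 (\<lambda>p. out (fst p) (snd p))"
    by (rule polytimeE[OF out, of "\<lambda>_. 3" 5]) (simp add: layout_def)
  obtain W where W: "poly_growth W" "\<And>xs V. fits xs V \<Longrightarrow>
      V \<le> W V \<and> length xs + len xs \<le> W V \<and> fits (xs @ map (out xs) [0..<len xs]) (W V)"
    using polytime_output_bound[OF len out] by blast
  define E where "E = D1 + D2 + 6"
  define T where "T = (\<lambda>V. T1 V + map_time (W V) (T2 (W V)) E + W V * (1 + W V))"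
  have "runs (map_program P1 P2 E) (init xs) (T V) (\<lambda>s. s = init (map (out xs) [0..<len xs])) \<and>
      input_size (map (out xs) [0..<len xs]) \<le> T V" if fits: "fits xs V" for xs V
  proof
    have V: "V \<le> W V" "length xs + len xs \<le> W V" "fits (xs @ map (out xs) [0..<len xs]) (W V)"
      using W(2)[OF fits] by auto
    from runs_map_program[OF P1(2) P2(2) _ _ fits V]
    show "runs (map_program P1 P2 E) (init xs) (T V) (\<lambda>s. s = init (map (out xs) [0..<len xs]))"
      by (rule runs_mono) (simp_all add: T_def E_def)
    have "fits (map (out xs) [0..<len xs]) (W V)" using V(3) unfolding fits_def by simp
    from input_size_le[OF this] show "input_size (map (out xs) [0..<len xs]) \<le> T V"
      unfolding T_def by (rule trans_le_add2)
  qed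
  moreover have "poly_growth T" unfolding T_def map_time_def
    by (intro poly_growth_intros poly_growth_loop_time poly_growth_compose[OF P2(1)] P1(1) W(1))
  ultimately show ?thesis unfolding polytime_map_def by blast
qed

lemma composed_time_le:
  fixes s t\<^sub>1 t\<^sub>2 C g W :: real
  assumes "1 \<le> W" "0 < C" "0 \<le> g" "t\<^sub>1 \<le> W ^ K" "s \<le> W ^ K" "t\<^sub>2 \<le> C * g * s ^ c" "0 \<le> s"
  shows "t\<^sub>1 + t\<^sub>2 \<le> (1 + C) * (1 + g) * W ^ (K + K * c)"
proof -
  have "W ^ K \<le> W ^ (K + K * c)" using assms(1) by (intro power_increasing) auto
  with assms(4) have first: "t\<^sub>1 \<le> W ^ (K + K * c)" by linarith
  have "s ^ c \<le> (W ^ K) ^ c" using assms(5,7) by (intro power_mono)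
  also have "\<dots> \<le> W ^ (K + K * c)" unfolding power_mult[symmetric] using assms(1) by (intro power_increasing) auto
  finally have "C * g * s ^ c \<le> C * g * W ^ (K + K * c)" using assms(2,3) by (intro mult_left_mono) auto
  with first assms(6) have "t\<^sub>1 + t\<^sub>2 \<le> (1 + C * g) * W ^ (K + K * c)" by (simp add: distrib_right)
  also have "\<dots> \<le> (1 + C) * (1 + g) * W ^ (K + K * c)"
    using assms(1-3) by (intro mult_right_mono) (simp_all add: algebra_simps)
  finally show ?thesis .
qed

lemma solvable_Ostar_reduction:
  fixes f g :: "nat \<Rightarrow> real"
  assumes solv: "solvable_Ostar B g" and F: "polytime_map F" and nonneg: "\<And>k. 0 \<le> g k"
    and reduces: "\<And>x. x \<in> instances A \<Longrightarrow>
      r x \<in> instances B \<and> encode B (r x) = F (encode A x) \<and> (yes_instance B (r x) \<longleftrightarrow> yes_instance A x)"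
    and fits: "\<And>x. x \<in> instances A \<Longrightarrow> fits (encode A x) (V x)"
    and time: "\<And>K. \<exists>C>0. \<exists>c. \<forall>x \<in> instances A.
      (1 + g (param B (r x))) * real (V x + 2) ^ K \<le> C * f (param A x) * real (input_size (encode A x)) ^ c"
  shows "solvable_Ostar A f"
proof -
  obtain P C c where C: "0 < C" and P: "\<And>y. y \<in> instances B \<Longrightarrow> \<exists>t s. exec P (init (encode B y)) t s \<and>
      (accepting s \<longleftrightarrow> yes_instance B y) \<and> real t \<le> C * g (param B y) * real (input_size (encode B y)) ^ c"
    using solv unfolding solvable_Ostar_def by blast
  obtain P0 T where T: "poly_growth T" and P0: "\<And>xs V. fits xs V \<Longrightarrow>
      runs P0 (init xs) (T V) (\<lambda>s. s = init (F xs)) \<and> input_size (F xs) \<le> T V"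
    using F unfolding polytime_map_def by blast
  obtain K where K: "\<And>V. T V \<le> (V + 2) ^ K" using T unfolding poly_growth_def by blast
  obtain C' c' where C': "0 < C'" and bound: "\<And>x. x \<in> instances A \<Longrightarrow>
      (1 + g (param B (r x))) * real (V x + 2) ^ (K + K * c) \<le> C' * f (param A x) * real (input_size (encode A x)) ^ c'"
    using time[of "K + K * c"] by blast
  have "\<exists>t s. exec (Seq P0 P) (init (encode A x)) t s \<and> (accepting s \<longleftrightarrow> yes_instance A x) \<and>
      real t \<le> (1 + C) * C' * f (param A x) * real (input_size (encode A x)) ^ c'" if x: "x \<in> instances A" for x
  proof -
    let ?k = "param B (r x)" and ?W = "real (V x + 2)"
    have enc: "r x \<in> instances B" "encode B (r x) = F (encode A x)" "yes_instance B (r x) \<longleftrightarrow> yes_instance A x"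
      using reduces[OF x] by blast+
    obtain t0 where t0: "exec P0 (init (encode A x)) t0 (init (F (encode A x)))" "t0 \<le> T (V x)"
      using P0[OF fits[OF x]] by (auto elim!: runsE)
    obtain t1 s where t1: "exec P (init (F (encode A x))) t1 s" "accepting s \<longleftrightarrow> yes_instance A x"
      "real t1 \<le> C * g ?k * real (input_size (F (encode A x))) ^ c"
      using P[OF enc(1)] unfolding enc(2,3) by blast
    have T_le: "real (T (V x)) \<le> ?W ^ K" using K[of "V x"] by (metis of_nat_le_iff of_nat_power)
    have "real t0 \<le> ?W ^ K" "real (input_size (F (encode A x))) \<le> ?W ^ K"
      using t0(2) P0[OF fits[OF x]] T_le by linarith+
    from composed_time_le[OF _ C nonneg this t1(3)]
    have "real t0 + real t1 \<le> (1 + C) * (1 + g ?k) * ?W ^ (K + K * c)" by simp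
    also have "\<dots> \<le> (1 + C) * (C' * f (param A x) * real (input_size (encode A x)) ^ c')"
      unfolding mult.assoc[of "1 + C"] using bound[OF x] C by (intro mult_left_mono) auto
    finally show ?thesis using exec.Seq[OF t0(1) t1(1)] t1(2) by (metis mult.assoc of_nat_add)
  qed
  moreover have "0 < (1 + C) * C'" using C C' by simp
  ultimately show ?thesis unfolding solvable_Ostar_def by blast
qed

lemma solvable_Ostar_mono:
  assumes "solvable_Ostar A f" "\<And>k. f k \<le> g k" shows "solvable_Ostar A g"
proof -
  obtain P C c where C: "0 < C" and P: "\<And>x. x \<in> instances A \<Longrightarrow> \<exists>t s. exec P (init (encode A x)) t s \<and>
      (accepting s \<longleftrightarrow> yes_instance A x) \<and> real t \<le> C * f (param A x) * real (input_size (encode A x)) ^ c"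
    using assms(1) unfolding solvable_Ostar_def by blast
  have "C * f k * real n ^ c \<le> C * g k * real n ^ c" for k n
    using C assms(2) by (intro mult_right_mono mult_left_mono) auto
  with P have "\<exists>t s. exec P (init (encode A x)) t s \<and> (accepting s \<longleftrightarrow> yes_instance A x) \<and>
      real t \<le> C * g (param A x) * real (input_size (encode A x)) ^ c" if "x \<in> instances A" for x
    using that by (meson order_trans)
  with C show ?thesis unfolding solvable_Ostar_def by blast
qed

section \<open>Hitting sets and vertex covers\<close>

definition block :: "nat \<Rightarrow> nat set \<Rightarrow> nat \<Rightarrow> nat set" where
  "block w X i = {r. r < w \<and> w * i + r \<in> X}"

definition glue :: "nat \<Rightarrow> nat \<Rightarrow> (nat \<Rightarrow> nat set) \<Rightarrow> nat set" where
  "glue w g A = {x. x < w * g \<and> x mod w \<in> A (x div w)}"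

lemma block_subset: "block w X i \<subseteq> {..<w}"
  unfolding block_def by auto

lemma finite_block [simp]: "finite (block w X i)"
  unfolding block_def by simp

lemma block_index_less:
  fixes w :: nat
  assumes "i < g" "r < w" shows "w * i + r < w * g"
proof -
  have "w * Suc i \<le> w * g" using assms(1) by (intro mult_le_mono2) simp
  then show ?thesis using assms(2) by simp
qed

lemma card_eq_sum_blocks:
  assumes "X \<subseteq> {..<w * g}" shows "card X = (\<Sum>i<g. card (block w X i))"
proof -
  have block: "card (X \<inter> {i * w..<i * w + w}) = card (block w X i)" for i
  proof -
    have "X \<inter> {i * w..<i * w + w} = (+) (w * i) ` block w X i"
    proof (intro equalityI subsetI)
      fix x assume "x \<in> X \<inter> {i * w..<i * w + w}"
      then show "x \<in> (+) (w * i) ` block w X i"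
        by (intro image_eqI[of _ _ "x - w * i"]) (auto simp: block_def mult.commute)
    qed (auto simp: block_def mult.commute)
    then show ?thesis by (simp add: card_image)
  qed
  have "card X = (\<Sum>x<g * w. of_bool (x \<in> X))"
    using assms by (simp add: of_bool_def sum.If_cases inf_absorb2 mult.commute)
  also have "\<dots> = (\<Sum>i<g. \<Sum>x\<in>{i * w..<i * w + w}. of_bool (x \<in> X))" by (rule sum.nat_group[symmetric])
  also have "\<dots> = (\<Sum>i<g. card (block w X i))"
    unfolding block[symmetric] by (simp add: of_bool_def sum.If_cases Int_commute)
  finally show ?thesis .
qed

lemma block_glue: "i < g \<Longrightarrow> A i \<subseteq> {..<w} \<Longrightarrow> block w (glue w g A) i = A i"
  unfolding block_def glue_def using block_index_less[of i g _ w] by auto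

lemma card_glue:
  assumes "\<And>i. i < g \<Longrightarrow> A i \<subseteq> {..<w}" shows "card (glue w g A) = (\<Sum>i<g. card (A i))"
proof -
  have "glue w g A \<subseteq> {..<w * g}" unfolding glue_def by auto
  from card_eq_sum_blocks[OF this] show ?thesis using assms by (simp add: block_glue)
qed

definition hitting_set :: "nat \<Rightarrow> nat \<Rightarrow> (nat \<Rightarrow> nat set) \<Rightarrow> nat set \<Rightarrow> bool" where
  "hitting_set k m F Y \<longleftrightarrow> Y \<subseteq> {..<k} \<and> (\<forall>j<m. Y \<inter> F j \<noteq> {})"

text \<open>
  Vertices below \<open>k\<close> are the elements, and vertex \<open>k * Suc j + b\<close> is slot \<open>b\<close> of the clique for the set \<open>F j\<close>.
  All cliques have \<open>k\<close> slots; a slot \<open>b \<notin> F j\<close> is made useless by joining it to every element.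
\<close>

definition slot_edge :: "nat \<Rightarrow> (nat \<Rightarrow> nat set) \<Rightarrow> nat \<Rightarrow> nat \<Rightarrow> bool" where
  "slot_edge k F x y \<longleftrightarrow> x < k \<and> k \<le> y \<and> (x = y mod k \<or> y mod k \<notin> F (y div k - 1))"

definition hitting_adj :: "nat \<Rightarrow> (nat \<Rightarrow> nat set) \<Rightarrow> nat \<Rightarrow> nat \<Rightarrow> bool" where
  "hitting_adj k F u v \<longleftrightarrow>
     (k \<le> u \<and> k \<le> v \<and> u div k = v div k \<and> u \<noteq> v) \<or> slot_edge k F u v \<or> slot_edge k F v u"

definition hitting_edges :: "nat \<Rightarrow> nat \<Rightarrow> (nat \<Rightarrow> nat set) \<Rightarrow> nat set set" where
  "hitting_edges k m F = {{u, v} | u v. u < k * Suc m \<and> v < k * Suc m \<and> hitting_adj k F u v}"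

lemma hitting_adj_sym: "hitting_adj k F u v \<longleftrightarrow> hitting_adj k F v u"
  unfolding hitting_adj_def by auto

lemma hitting_adj_irrefl: "\<not> hitting_adj k F u u"
  unfolding hitting_adj_def slot_edge_def by auto

lemma hitting_edges_iff:
  "u < k * Suc m \<Longrightarrow> v < k * Suc m \<Longrightarrow> {u, v} \<in> hitting_edges k m F \<longleftrightarrow> hitting_adj k F u v"
  unfolding hitting_edges_def using hitting_adj_sym by (auto simp: doubleton_eq_iff)

lemma simple_graph_hitting_edges: "simple_graph {0..<k * Suc m} (hitting_edges k m F)"
  unfolding simple_graph_def
proof (intro conjI ballI)
  fix e assume "e \<in> hitting_edges k m F"
  then obtain u v where "e = {u, v}" "u < k * Suc m" "v < k * Suc m" "hitting_adj k F u v"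
    unfolding hitting_edges_def by blast
  moreover then have "u \<noteq> v" using hitting_adj_irrefl by metis
  ultimately show "e \<subseteq> {0..<k * Suc m}" "card e = 2" by auto
qed simp

lemma chordal_disjoint_cliques:
  assumes edges: "\<And>u v. u \<in> V \<Longrightarrow> v \<in> V \<Longrightarrow> {u, v} \<in> E \<longleftrightarrow> u \<noteq> v \<and> f u = f v"
  shows "chordal V E"
  unfolding chordal_def
proof (intro allI impI, elim conjE)
  fix vs assume cycle: "is_cycle V E vs" and len: "4 \<le> length vs"
  have in_V: "vs ! i \<in> V" if "i < length vs" for i
    using cycle that unfolding is_cycle_def by auto
  have "f (vs ! i) = f (vs ! Suc i)" if "Suc i < length vs" for i
  proof -
    have "{vs ! i, vs ! Suc i} \<in> E" using cycle that unfolding is_cycle_def by (metis Suc_lessD mod_less)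
    then show ?thesis using edges in_V that by simp
  qed
  from this[of 0] this[of 1] have "f (vs ! 0) = f (vs ! 2)" using len by (simp add: numeral_2_eq_2)
  moreover have "vs ! 0 \<noteq> vs ! 2"
    using cycle len nth_eq_iff_index_eq[of vs 0 2] unfolding is_cycle_def by force
  moreover have "vs ! 0 \<in> V" "vs ! 2 \<in> V" using in_V[of 0] in_V[of 2] len by linarith+
  ultimately have "{vs ! 0, vs ! 2} \<in> E" using edges by blast
  then show "has_chord E vs"
    unfolding has_chord_def using len by (intro exI[of _ 0] exI[of _ 2] conjI) auto
qed

lemma chordal_deletion_set_elements:
  "chordal_deletion_set {0..<k * Suc m} (hitting_edges k m F) {0..<k}"
  unfolding chordal_deletion_set_def
proof
  show "chordal ({0..<k * Suc m} - {0..<k}) {e \<in> hitting_edges k m F. e \<inter> {0..<k} = {}}"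
    by (rule chordal_disjoint_cliques[of _ _ "\<lambda>u. u div k"])
      (auto simp: hitting_edges_iff hitting_adj_def slot_edge_def simp del: mult_Suc_right)
qed auto

lemma slot_simps:
  fixes k :: nat
  shows "b < k \<Longrightarrow> (k * Suc j + b) div k = Suc j" "b < k \<Longrightarrow> (k * Suc j + b) mod k = b"
    and "k \<le> k * Suc j + b" "\<not> k * Suc j + b < k"
  by (simp_all del: mult_Suc_right) simp_all

lemma slot_exists:
  fixes k :: nat
  assumes "k \<le> v" "v < k * Suc m" shows "\<exists>j<m. \<exists>b<k. v = k * Suc j + b"
proof -
  have k: "0 < k" using assms by (cases k) auto
  then have "0 < v div k" using assms(1) by (simp add: div_greater_zero_iff)
  moreover have "v div k < Suc m" using assms(2) by (metis less_mult_imp_div_less mult.commute)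
  ultimately obtain j where "v div k = Suc j" "j < m" by (cases "v div k") auto
  then show ?thesis using k mod_less_divisor mult_div_mod_eq by metis
qed

lemma hitting_adj_element_slot: "a < k \<Longrightarrow> b < k \<Longrightarrow> hitting_adj k F a (k * Suc j + b) \<longleftrightarrow> a = b \<or> b \<notin> F j"
  unfolding hitting_adj_def slot_edge_def by (simp add: slot_simps del: mult_Suc_right)

lemma hitting_adj_slots: "b < k \<Longrightarrow> b' < k \<Longrightarrow> hitting_adj k F (k * Suc i + b) (k * Suc j + b') \<longleftrightarrow> i = j \<and> b \<noteq> b'"
  unfolding hitting_adj_def slot_edge_def by (auto simp: slot_simps simp del: mult_Suc_right)

definition hitting_cover :: "nat \<Rightarrow> nat \<Rightarrow> nat set \<Rightarrow> (nat \<Rightarrow> nat) \<Rightarrow> nat set" where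
  "hitting_cover k m Y b = glue k (Suc m) (case_nat Y (\<lambda>j. {..<k} - {b j}))"

lemma card_hitting_cover:
  assumes "Y \<subseteq> {..<k}" "\<And>j. j < m \<Longrightarrow> b j < k"
  shows "card (hitting_cover k m Y b) = card Y + m * (k - 1)"
proof -
  have "card (hitting_cover k m Y b) = (\<Sum>j<Suc m. card (case_nat Y (\<lambda>j. {..<k} - {b j}) j))"
    unfolding hitting_cover_def by (rule card_glue) (use assms(1) in \<open>auto split: nat.splits\<close>)
  also have "\<dots> = card Y + (\<Sum>j<m. card ({..<k} - {b j}))" by (subst sum.lessThan_Suc_shift) simp
  also have "(\<Sum>j<m. card ({..<k} - {b j})) = (\<Sum>j<m. k - 1)"
    by (rule sum.cong) (use assms(2) in auto)
  finally show ?thesis by simp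
qed

lemma vertex_cover_hitting_cover:
  assumes Y: "Y \<subseteq> {..<k}" and b: "\<And>j. j < m \<Longrightarrow> b j \<in> Y \<inter> F j"
  shows "vertex_cover {0..<k * Suc m} (hitting_edges k m F) (hitting_cover k m Y b)"
  unfolding vertex_cover_def
proof (intro conjI ballI)
  let ?X = "hitting_cover k m Y b"
  show "?X \<subseteq> {0..<k * Suc m}" unfolding hitting_cover_def glue_def by auto
  have element: "a \<in> ?X" if "a \<in> Y" for a
    using that Y unfolding hitting_cover_def glue_def by (auto simp: trans_less_add1)
  have slot: "k * Suc j + c \<in> ?X" if "j < m" "c < k" "c \<noteq> b j" for j c
    using that block_index_less[of "Suc j" "Suc m" c k] unfolding hitting_cover_def glue_def
    by (simp add: slot_simps del: mult_Suc_right)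
  have covered: "u \<in> ?X \<or> v \<in> ?X" if "slot_edge k F u v" "v < k * Suc m" for u v
  proof -
    have "k \<le> v" using that(1) unfolding slot_edge_def by blast
    from slot_exists[OF this that(2)] obtain j c where v: "j < m" "c < k" "v = k * Suc j + c" by blast
    then show ?thesis
      using that(1) b[OF v(1)] slot[OF v(1,2)] element unfolding slot_edge_def
      by (auto simp: slot_simps simp del: mult_Suc_right)
  qed
  fix e assume "e \<in> hitting_edges k m F"
  then obtain u v where e: "e = {u, v}" and uv: "u < k * Suc m" "v < k * Suc m" "hitting_adj k F u v"
    unfolding hitting_edges_def by blast
  have "u \<in> ?X \<or> v \<in> ?X"
  proof (cases "slot_edge k F u v \<or> slot_edge k F v u")
    case True
    then show ?thesis using covered uv by blast
  next
    case False
    then have "k \<le> u" "k \<le> v" using uv(3) unfolding hitting_adj_def by auto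
    from slot_exists[OF this(1) uv(1)] slot_exists[OF this(2) uv(2)] obtain i c j d
      where ij: "i < m" "c < k" "u = k * Suc i + c" "j < m" "d < k" "v = k * Suc j + d" by blast
    then show ?thesis using uv(3) slot unfolding ij(3,6) hitting_adj_slots[OF ij(2,5)] by metis
  qed
  then show "e \<inter> ?X \<noteq> {}" using e by auto
qed

context
  fixes k m :: nat and F :: "nat \<Rightarrow> nat set" and X :: "nat set"
  assumes cover: "vertex_cover {0..<k * Suc m} (hitting_edges k m F) X"
begin

lemma adjacent_covered: "u < k * Suc m \<Longrightarrow> v < k * Suc m \<Longrightarrow> hitting_adj k F u v \<Longrightarrow> u \<in> X \<or> v \<in> X"
  using cover hitting_edges_iff[of u k m v F] unfolding vertex_cover_def by auto

lemma clique_minus_slot_covered: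
  assumes "j < m" "b < k" "b \<notin> block k X (Suc j)" shows "{..<k} - {b} \<subseteq> block k X (Suc j)"
proof
  fix c assume c: "c \<in> {..<k} - {b}"
  then have "k * Suc j + b \<in> X \<or> k * Suc j + c \<in> X"
    using assms(1,2) block_index_less[of "Suc j" "Suc m" _ k]
    by (intro adjacent_covered) (simp_all add: hitting_adj_slots del: mult_Suc_right)
  then show "c \<in> block k X (Suc j)" using c assms unfolding block_def by simp
qed

lemma neighbour_of_missing_slot_covered:
  assumes "j < m" "b < k" "b \<notin> block k X (Suc j)" "a < k" "a = b \<or> b \<notin> F j" shows "a \<in> block k X 0"
proof -
  have "a \<in> X \<or> k * Suc j + b \<in> X"
    using assms block_index_less[of "Suc j" "Suc m" b k]
    by (intro adjacent_covered) (simp_all add: hitting_adj_element_slot trans_less_add1 del: mult_Suc_right, simp)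
  then show ?thesis using assms unfolding block_def by simp
qed

lemma card_clique_covered:
  assumes "0 < k" "j < m" shows "k - 1 + of_bool (block k X (Suc j) = {..<k}) \<le> card (block k X (Suc j))"
proof (cases "block k X (Suc j) = {..<k}")
  case False
  then obtain b where b: "b < k" "b \<notin> block k X (Suc j)" using block_subset by blast
  from card_mono[OF finite_block clique_minus_slot_covered[OF assms(2) b]] show ?thesis using b(1) False by simp
qed (use assms(1) in simp)

lemma card_elements_covered:
  assumes "0 < k" "card X = B + m * (k - 1)"
  shows "card (block k X 0) + card {j. j < m \<and> block k X (Suc j) = {..<k}} \<le> B"
proof -
  have "X \<subseteq> {..<k * Suc m}" using cover unfolding vertex_cover_def by auto
  from card_eq_sum_blocks[OF this] have "B + m * (k - 1) = card (block k X 0) + (\<Sum>j<m. card (block k X (Suc j)))"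
    unfolding assms(2) sum.lessThan_Suc_shift by simp
  moreover have "m * (k - 1) + card {j. j < m \<and> block k X (Suc j) = {..<k}} =
      (\<Sum>j<m. k - 1 + of_bool (block k X (Suc j) = {..<k}))"
    by (simp add: sum.distrib of_bool_def sum.If_cases Int_def)
  moreover have "\<dots> \<le> (\<Sum>j<m. card (block k X (Suc j)))"
    by (rule sum_mono) (use card_clique_covered[OF assms(1)] in auto)
  ultimately show ?thesis by linarith
qed

text \<open>A clique contained in the cover costs one extra vertex, which pays for an element of \<open>F j\<close>.\<close>

lemma hitting_set_of_vertex_cover:
  assumes card: "card X = B + m * (k - 1)" and B: "B < k" and F: "\<And>j. j < m \<Longrightarrow> F j \<subseteq> {..<k} \<and> F j \<noteq> {}"
  shows "\<exists>Y. hitting_set k m F Y \<and> card Y \<le> B"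
proof -
  have "\<forall>j. \<exists>a. j < m \<longrightarrow> a \<in> F j" using F by blast
  then obtain a where a: "\<And>j. j < m \<Longrightarrow> a j \<in> F j" by metis
  let ?full = "{j. j < m \<and> block k X (Suc j) = {..<k}}"
  let ?Y = "block k X 0 \<union> a ` ?full"
  have "card ?Y \<le> card (block k X 0) + card (a ` ?full)" by (rule card_Un_le)
  also have "\<dots> \<le> card (block k X 0) + card ?full" by (simp add: card_image_le)
  also have "\<dots> \<le> B" by (rule card_elements_covered[OF _ card]) (use B in simp)
  finally have card_Y: "card ?Y \<le> B" .
  have "?Y \<inter> F j \<noteq> {}" if j: "j < m" for j
  proof (cases "block k X (Suc j) = {..<k}")
    case True
    then show ?thesis using a j by blast
  next
    case False
    then obtain b where b: "b < k" "b \<notin> block k X (Suc j)" using block_subset by blast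
    have "b \<in> F j"
    proof (rule ccontr)
      assume "b \<notin> F j"
      then have "{..<k} \<subseteq> ?Y" using neighbour_of_missing_slot_covered[OF j b] by auto
      then have "k \<le> card ?Y" using card_mono[of ?Y "{..<k}"] by simp
      then show False using card_Y B by simp
    qed
    then show ?thesis using neighbour_of_missing_slot_covered[OF j b b(1)] by blast
  qed
  moreover have "?Y \<subseteq> {..<k}" using a F block_subset by fastforce
  ultimately show ?thesis using card_Y unfolding hitting_set_def by blast
qed

end

theorem vertex_cover_iff_hitting_set:
  assumes B: "B < k" and F: "\<And>j. j < m \<Longrightarrow> F j \<subseteq> {..<k} \<and> F j \<noteq> {}"
  shows "(\<exists>X. vertex_cover {0..<k * Suc m} (hitting_edges k m F) X \<and> card X = B + m * (k - 1)) \<longleftrightarrow>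
    (\<exists>Y. hitting_set k m F Y \<and> card Y \<le> B)"
proof
  assume "\<exists>Y. hitting_set k m F Y \<and> card Y \<le> B"
  then obtain Y' where "hitting_set k m F Y'" "card Y' \<le> B" by blast
  then obtain Y where "Y' \<subseteq> Y" "Y \<subseteq> {..<k}" "card Y = B"
    using exists_subset_between[of Y' B "{..<k}"] B unfolding hitting_set_def by auto
  with \<open>hitting_set k m F Y'\<close> have Y: "hitting_set k m F Y" "card Y = B" unfolding hitting_set_def by blast+
  then have "\<forall>j. \<exists>b. j < m \<longrightarrow> b \<in> Y \<inter> F j" unfolding hitting_set_def by blast
  then obtain b where b: "\<And>j. j < m \<Longrightarrow> b j \<in> Y \<inter> F j" by metis
  then have "card (hitting_cover k m Y b) = B + m * (k - 1)"
    using Y F by (subst card_hitting_cover) (auto simp: hitting_set_def)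
  with vertex_cover_hitting_cover[of Y k m b F] b Y(1)
  show "\<exists>X. vertex_cover {0..<k * Suc m} (hitting_edges k m F) X \<and> card X = B + m * (k - 1)"
    unfolding hitting_set_def by blast
next
  assume "\<exists>X. vertex_cover {0..<k * Suc m} (hitting_edges k m F) X \<and> card X = B + m * (k - 1)"
  then show "\<exists>Y. hitting_set k m F Y \<and> card Y \<le> B"
    by (elim exE conjE) (rule hitting_set_of_vertex_cover[OF _ _ B F])
qed

section \<open>From formulas to hitting sets\<close>

lemma set_encode_less:
  assumes "A \<subseteq> {..<n}" shows "set_encode A < 2 ^ n"
proof -
  have "set_encode A \<le> (\<Sum>i\<in>{..<n}. 2 ^ i)" unfolding set_encode_def by (rule sum_mono2) (use assms in auto)
  also have "\<dots> < 2 ^ n" by (simp add: sum_power2 lessThan_atLeast0)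
  finally show ?thesis .
qed

lemma is_qcnf_clause:
  assumes "is_qcnf q n F" "c \<in> set F"
  shows "length c \<le> q" "i < length c \<Longrightarrow> fst (c ! i) < n"
  using assms nth_mem[of i c] unfolding is_qcnf_def by (auto simp: case_prod_beta)

text \<open>A group of \<open>p\<close> variables is represented by a block of \<open>2 * h\<close> elements, whose half-size subsets \<open>dec\<close> decodes.\<close>

locale group_code =
  fixes p h q :: nat and dec :: "nat set \<Rightarrow> nat set"
  assumes p_pos: "0 < p" and h_pos: "0 < h"
    and dec_surj: "\<And>A. A \<subseteq> {..<p} \<Longrightarrow> \<exists>X \<subseteq> {..<2 * h}. card X = h \<and> dec X = A"
begin

definition groups :: "nat \<Rightarrow> nat" where "groups n = n div p + 1"

definition elems :: "nat \<Rightarrow> nat" where "elems n = 2 * h * groups n"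

definition assignment :: "nat set \<Rightarrow> nat \<Rightarrow> bool" where
  "assignment Y v \<longleftrightarrow> v mod p \<in> dec (block (2 * h) Y (v div p))"

definition balanced :: "nat \<Rightarrow> nat set \<Rightarrow> bool" where
  "balanced n Y \<longleftrightarrow> Y \<subseteq> {..<elems n} \<and> (\<forall>g < groups n. card (block (2 * h) Y g) = h)"

text \<open>The numbers \<open>z < num_tuples\<close> enumerate the \<open>Suc q\<close>-tuples of subsets of a block.\<close>

definition tuple :: "nat \<Rightarrow> nat \<Rightarrow> nat set" where "tuple z i = block (2 * h) (set_decode z) i"

definition num_tuples :: nat where "num_tuples = 2 ^ (2 * h * Suc q)"

text \<open>Hitting all \<open>balance_set\<close>s of a block forces at least \<open>h\<close> of its elements.\<close>

definition balance_set :: "nat \<Rightarrow> nat \<Rightarrow> nat \<Rightarrow> nat set" where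
  "balance_set n g z =
    {a. a < elems n \<and> a div (2 * h) = g \<and> (card (tuple z 0) \<le> h \<or> a mod (2 * h) \<in> tuple z 0)}"

definition falsified :: "nat \<Rightarrow> nat \<Rightarrow> literal \<Rightarrow> bool" where
  "falsified z i l \<longleftrightarrow> (fst l mod p \<in> dec (tuple z i)) \<noteq> snd l"

text \<open>Padding every clause to \<open>Suc q\<close> positions keeps the sets of the empty clause nonempty.\<close>

definition clause_group :: "literal list \<Rightarrow> nat \<Rightarrow> nat" where
  "clause_group c i = (if i < length c then fst (c ! i) div p else 0)"

text \<open>
  A balanced set misses the last part of \<open>clause_set\<close> only if it agrees with the tuple \<open>z\<close> on every block of the
  clause. The set is everything and imposes nothing unless such an agreement would falsify the clause.
\<close>

definition clause_set :: "nat \<Rightarrow> literal list \<Rightarrow> nat \<Rightarrow> nat set" where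
  "clause_set n c z = {a. a < elems n \<and>
     ((\<exists>i \<le> q. h < card (tuple z i)) \<or> (\<exists>i<length c. \<not> falsified z i (c ! i)) \<or>
      (\<exists>i \<le> q. clause_group c i = a div (2 * h) \<and> a mod (2 * h) \<notin> tuple z i))}"

definition target :: "nat \<Rightarrow> cnf \<Rightarrow> nat \<Rightarrow> nat set" where
  "target n F j = (if j div num_tuples < groups n then balance_set n (j div num_tuples) (j mod num_tuples)
     else clause_set n (F ! (j div num_tuples - groups n)) (j mod num_tuples))"

definition num_targets :: "nat \<Rightarrow> nat \<Rightarrow> nat" where
  "num_targets n m = (groups n + m) * num_tuples"

lemma groups_pos: "0 < groups n"
  unfolding groups_def by simp

lemma group_less: "v < n \<Longrightarrow> v div p < groups n"
  unfolding groups_def using div_le_mono[of v n p] by simp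

lemma element_less: "g < groups n \<Longrightarrow> r < 2 * h \<Longrightarrow> 2 * h * g + r < elems n"
  unfolding elems_def by (rule block_index_less)

lemma in_balance_set_iff:
  "g < groups n \<Longrightarrow> r < 2 * h \<Longrightarrow> 2 * h * g + r \<in> balance_set n g' z \<longleftrightarrow> g = g' \<and> (card (tuple z 0) \<le> h \<or> r \<in> tuple z 0)"
  unfolding balance_set_def using element_less[of g n r] by simp

lemma in_clause_set_iff:
  "g < groups n \<Longrightarrow> r < 2 * h \<Longrightarrow> 2 * h * g + r \<in> clause_set n c z \<longleftrightarrow>
    (\<exists>i \<le> q. h < card (tuple z i)) \<or> (\<exists>i<length c. \<not> falsified z i (c ! i)) \<or>
    (\<exists>i \<le> q. clause_group c i = g \<and> r \<notin> tuple z i)"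
  unfolding clause_set_def using element_less[of g n r] by simp

lemma tuple_subset: "tuple z i \<subseteq> {..<2 * h}"
  unfolding tuple_def by (rule block_subset)

lemma num_tuples_pos: "0 < num_tuples"
  unfolding num_tuples_def by simp

lemma tuple_exists:
  assumes "\<And>i. i \<le> q \<Longrightarrow> X i \<subseteq> {..<2 * h}" shows "\<exists>z<num_tuples. \<forall>i \<le> q. tuple z i = X i"
proof (intro exI conjI allI impI)
  let ?A = "glue (2 * h) (Suc q) X"
  have A: "?A \<subseteq> {..<2 * h * Suc q}" unfolding glue_def by auto
  then show "set_encode ?A < num_tuples" unfolding num_tuples_def by (rule set_encode_less)
  fix i assume "i \<le> q"
  moreover have "finite ?A" using A finite_subset by blast
  ultimately show "tuple (set_encode ?A) i = X i"
    unfolding tuple_def using assms by (simp add: block_glue)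
qed

lemma all_targets_iff:
  "(\<forall>j < num_targets n (length F). Q (target n F j)) \<longleftrightarrow>
    (\<forall>g < groups n. \<forall>z < num_tuples. Q (balance_set n g z)) \<and> (\<forall>c \<in> set F. \<forall>z < num_tuples. Q (clause_set n c z))"
  (is "?targets \<longleftrightarrow> ?balance \<and> ?clause")
proof (intro iffI conjI allI ballI impI; (elim conjE)?)
  have index: "num_tuples * b + z < num_targets n (length F)" if "b < groups n + length F" "z < num_tuples" for b z
    using block_index_less[OF that] unfolding num_targets_def by (simp add: mult.commute)
  assume targets: ?targets
  show "Q (balance_set n g z)" if "g < groups n" "z < num_tuples" for g z
    using targets[rule_format, OF index[of g z]] that unfolding target_def by simp
  fix c z assume "c \<in> set F" and z: "z < num_tuples"
  then obtain m where m: "m < length F" "c = F ! m" by (metis in_set_conv_nth)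
  then show "Q (clause_set n c z)"
    using targets[rule_format, OF index[of "groups n + m" z]] z unfolding target_def by simp
next
  fix j assume j: "j < num_targets n (length F)" and Q: ?balance ?clause
  have mod: "j mod num_tuples < num_tuples" using num_tuples_pos by simp
  have div: "j div num_tuples < groups n + length F"
    using j unfolding num_targets_def by (simp add: less_mult_imp_div_less)
  then have "F ! (j div num_tuples - groups n) \<in> set F" if "\<not> j div num_tuples < groups n"
    using that by (intro nth_mem) simp
  then show "Q (target n F j)" using Q mod unfolding target_def by simp
qed

lemma target_nonempty:
  assumes qcnf: "is_qcnf q n F" and j: "j < num_targets n (length F)"
  shows "target n F j \<subseteq> {..<elems n} \<and> target n F j \<noteq> {}"
proof -
  have "balance_set n g z \<noteq> {}" if g: "g < groups n" for g z
  proof -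
    obtain r where "r < 2 * h" "card (tuple z 0) \<le> h \<or> r \<in> tuple z 0"
    proof (cases "card (tuple z 0) \<le> h")
      case False
      then have "tuple z 0 \<noteq> {}" using h_pos by auto
      then obtain r where "r < 2 * h" "r \<in> tuple z 0" using tuple_subset[of z 0] by auto
      then show thesis using that by blast
    qed (use that[of 0] h_pos in simp)
    then show ?thesis using in_balance_set_iff[OF g] by blast
  qed
  moreover have "clause_set n c z \<noteq> {}" if c: "c \<in> set F" for c z
  proof -
    obtain r where r: "r < 2 * h" "h < card (tuple z 0) \<or> r \<notin> tuple z 0"
    proof (cases "h < card (tuple z 0)")
      case False
      then have "card (tuple z 0) < card {..<2 * h}" using h_pos by simp
      then obtain r where "r \<in> {..<2 * h} - tuple z 0"
        using tuple_subset by (metis DiffI less_irrefl subsetI subset_antisym)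
      then have "r < 2 * h" "r \<notin> tuple z 0" by simp_all
      then show thesis using that by blast
    qed (use that[of 0] h_pos in simp)
    have "clause_group c 0 < groups n"
      using is_qcnf_clause[OF qcnf c] group_less groups_pos unfolding clause_group_def by simp
    from in_clause_set_iff[OF this r(1)] r(2) have "2 * h * clause_group c 0 + r \<in> clause_set n c z" by auto
    then show ?thesis by blast
  qed
  ultimately have "\<forall>j < num_targets n (length F). target n F j \<subseteq> {..<elems n} \<and> target n F j \<noteq> {}"
    unfolding all_targets_iff[of n F "\<lambda>A. A \<subseteq> {..<elems n} \<and> A \<noteq> {}"]
    by (auto simp: balance_set_def clause_set_def)
  with j show ?thesis by blast
qed

lemma block_nonempty_hits:
  "r \<in> block (2 * h) Y g \<Longrightarrow> 2 * h * g + r \<in> A \<Longrightarrow> Y \<inter> A \<noteq> {}"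
  unfolding block_def by blast

lemma card_balanced: "balanced n Y \<Longrightarrow> card Y = h * groups n"
  unfolding balanced_def elems_def using card_eq_sum_blocks[of Y "2 * h" "groups n"] by simp

lemma balanced_exists: "\<exists>Y. balanced n Y \<and> (\<forall>v<n. assignment Y v = \<alpha> v)"
proof -
  have "\<forall>g. \<exists>X. X \<subseteq> {..<2 * h} \<and> card X = h \<and> dec X = {r. r < p \<and> \<alpha> (p * g + r)}"
    using dec_surj[of "{r. r < p \<and> \<alpha> (p * g + r)}" for g]
    by (metis (no_types, lifting) lessThan_iff mem_Collect_eq subsetI)
  then obtain H where H: "\<And>g. H g \<subseteq> {..<2 * h}" "\<And>g. card (H g) = h" "\<And>g. dec (H g) = {r. r < p \<and> \<alpha> (p * g + r)}"
    by metis
  let ?Y = "glue (2 * h) (groups n) H"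
  have blocks: "block (2 * h) ?Y g = H g" if "g < groups n" for g using block_glue that H(1) .
  have "?Y \<subseteq> {..<elems n}" unfolding glue_def elems_def by auto
  then have "balanced n ?Y" unfolding balanced_def using blocks H(2) by simp
  moreover have "assignment ?Y v = \<alpha> v" if "v < n" for v
    unfolding assignment_def using blocks[OF group_less[OF that]] H(3) p_pos by simp
  ultimately show ?thesis by blast
qed

lemma balanced_hits_balance_set:
  assumes Y: "balanced n Y" and g: "g < groups n" shows "Y \<inter> balance_set n g z \<noteq> {}"
proof -
  let ?B = "block (2 * h) Y g"
  have card: "card ?B = h" using Y g unfolding balanced_def by blast
  obtain r where r: "r \<in> ?B" "card (tuple z 0) \<le> h \<or> r \<in> tuple z 0"
  proof (cases "card (tuple z 0) \<le> h")
    case True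
    have "?B \<noteq> {}" using card h_pos by auto
    with True that show thesis by blast
  next
    case False
    have "?B \<inter> tuple z 0 \<noteq> {}"
    proof
      assume "?B \<inter> tuple z 0 = {}"
      then have "card ?B + card (tuple z 0) = card (?B \<union> tuple z 0)"
        by (intro card_Un_disjoint[symmetric]) (simp_all add: tuple_def)
      also have "\<dots> \<le> card {..<2 * h}" using block_subset tuple_subset by (intro card_mono) auto
      finally show False using card False by simp
    qed
    with that show thesis by blast
  qed
  moreover have "r < 2 * h" using r(1) block_subset by blast
  ultimately show ?thesis using block_nonempty_hits in_balance_set_iff[OF g] by blast
qed

lemma balanced_if_hits_balance_sets:
  assumes Y: "Y \<subseteq> {..<elems n}" "card Y \<le> h * groups n"
    and hits: "\<And>g z. g < groups n \<Longrightarrow> z < num_tuples \<Longrightarrow> Y \<inter> balance_set n g z \<noteq> {}"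
  shows "balanced n Y"
proof -
  have lower: "h \<le> card (block (2 * h) Y g)" if g: "g < groups n" for g
  proof (rule ccontr)
    assume "\<not> h \<le> card (block (2 * h) Y g)"
    then have large: "h < card ({..<2 * h} - block (2 * h) Y g)"
      using block_subset[of "2 * h" Y g] by (simp add: card_Diff_subset)
    obtain z where z: "z < num_tuples" "tuple z 0 = {..<2 * h} - block (2 * h) Y g"
      using tuple_exists[of "\<lambda>_. {..<2 * h} - block (2 * h) Y g"] by auto
    obtain a where a: "a \<in> Y" "a \<in> balance_set n g z" using hits[OF g z(1)] by blast
    then have "a mod (2 * h) \<in> block (2 * h) Y g"
      using h_pos unfolding balance_set_def block_def by auto
    with a(2) large show False unfolding balance_set_def z(2) by auto
  qed
  have "(\<Sum>g<groups n. card (block (2 * h) Y g)) \<le> (\<Sum>g<groups n. h)"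
    using Y card_eq_sum_blocks[of Y "2 * h" "groups n"] unfolding elems_def by (simp add: mult.commute)
  moreover have "(\<Sum>g<groups n. h) \<le> (\<Sum>g<groups n. card (block (2 * h) Y g))" by (rule sum_mono) (use lower in simp)
  ultimately have sums_eq: "(\<Sum>g<groups n. h) = (\<Sum>g<groups n. card (block (2 * h) Y g))" by simp
  have "card (block (2 * h) Y g) = h" if "g < groups n" for g
    using sum_mono_inv[OF sums_eq lower, of g] that by simp
  with Y(1) show ?thesis unfolding balanced_def by blast
qed

lemma balanced_hits_clause_set:
  assumes Y: "balanced n Y" and qcnf: "is_qcnf q n F" "c \<in> set F" and sat: "\<exists>(v, b) \<in> set c. assignment Y v = b"
  shows "Y \<inter> clause_set n c z \<noteq> {}"
proof -
  obtain i where i: "i < length c" "assignment Y (fst (c ! i)) = snd (c ! i)"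
    using sat by (auto simp: in_set_conv_nth split: prod.splits)
  let ?g = "fst (c ! i) div p"
  let ?B = "block (2 * h) Y ?g"
  have g: "?g < groups n" and iq: "i \<le> q"
    using is_qcnf_clause[OF qcnf] i(1) by (auto intro: group_less)
  have card: "card ?B = h" using Y g unfolding balanced_def by blast
  obtain r where r: "r \<in> ?B" "h < card (tuple z i) \<or> \<not> falsified z i (c ! i) \<or> r \<notin> tuple z i"
  proof (cases "card (tuple z i) \<le> h \<and> ?B \<subseteq> tuple z i")
    case True
    then have "tuple z i = ?B" using card by (intro card_seteq[symmetric]) (simp_all add: tuple_def)
    then have "\<not> falsified z i (c ! i)" using i(2) unfolding falsified_def assignment_def by simp
    moreover have "?B \<noteq> {}" using card h_pos by auto
    ultimately show thesis using that by blast
  next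
    case False
    moreover have "?B \<noteq> {}" using card h_pos by auto
    ultimately show thesis using that by (meson ex_in_conv not_le subsetI)
  qed
  moreover have "r < 2 * h" using r(1) block_subset by blast
  moreover have "clause_group c i = ?g" using i(1) unfolding clause_group_def by simp
  ultimately have "2 * h * ?g + r \<in> clause_set n c z" using in_clause_set_iff[OF g] i(1) iq by blast
  with r(1) show ?thesis by (rule block_nonempty_hits)
qed

lemma satisfied_if_hits_clause_sets:
  assumes Y: "balanced n Y" and qcnf: "is_qcnf q n F" "c \<in> set F"
    and hits: "\<And>z. z < num_tuples \<Longrightarrow> Y \<inter> clause_set n c z \<noteq> {}"
  shows "\<exists>(v, b) \<in> set c. assignment Y v = b"
proof (rule ccontr)
  assume unsat: "\<not> (\<exists>(v, b) \<in> set c. assignment Y v = b)"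
  obtain z where z: "z < num_tuples" "\<And>i. i \<le> q \<Longrightarrow> tuple z i = block (2 * h) Y (clause_group c i)"
    using tuple_exists[of "\<lambda>i. block (2 * h) Y (clause_group c i)"] block_subset by blast
  have "clause_group c i < groups n" for i
    using is_qcnf_clause[OF qcnf] group_less groups_pos unfolding clause_group_def by simp
  then have half: "card (tuple z i) = h" if "i \<le> q" for i
    using Y z(2)[OF that] unfolding balanced_def by simp
  have fals: "falsified z i (c ! i)" if "i < length c" for i
    using unsat nth_mem[OF that] z(2)[of i] that is_qcnf_clause(1)[OF qcnf]
    unfolding falsified_def assignment_def clause_group_def by (auto simp: case_prod_beta)
  obtain a where a: "a \<in> Y" "a \<in> clause_set n c z" using hits[OF z(1)] by blast
  then obtain i where "i \<le> q" "clause_group c i = a div (2 * h)" "a mod (2 * h) \<notin> tuple z i"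
    using half fals unfolding clause_set_def by auto
  moreover have "a mod (2 * h) \<in> block (2 * h) Y (a div (2 * h))" unfolding block_def using a(1) h_pos by simp
  ultimately show False using z(2) by simp
qed

theorem satisfiable_iff_hitting_set:
  assumes qcnf: "is_qcnf q n F"
  shows "satisfiable F \<longleftrightarrow>
    (\<exists>Y. hitting_set (elems n) (num_targets n (length F)) (target n F) Y \<and> card Y \<le> h * groups n)"
proof
  assume "satisfiable F"
  then obtain \<alpha> where \<alpha>: "\<And>c. c \<in> set F \<Longrightarrow> \<exists>(v, b) \<in> set c. \<alpha> v = b" unfolding satisfiable_def by blast
  obtain Y where Y: "balanced n Y" "\<And>v. v < n \<Longrightarrow> assignment Y v = \<alpha> v" using balanced_exists by blast
  have "\<exists>(v, b) \<in> set c. assignment Y v = b" if "c \<in> set F" for c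
  proof -
    from \<alpha>[OF that] obtain v b where "(v, b) \<in> set c" "\<alpha> v = b" by blast
    moreover then have "v < n" using qcnf that unfolding is_qcnf_def by fastforce
    ultimately show ?thesis using Y(2) by blast
  qed
  then have "\<forall>j < num_targets n (length F). Y \<inter> target n F j \<noteq> {}"
    unfolding all_targets_iff[of n F "\<lambda>A. Y \<inter> A \<noteq> {}"]
    using balanced_hits_balance_set[OF Y(1)] balanced_hits_clause_set[OF Y(1) qcnf] by blast
  then show "\<exists>Y. hitting_set (elems n) (num_targets n (length F)) (target n F) Y \<and> card Y \<le> h * groups n"
    using Y(1) card_balanced[OF Y(1)] unfolding hitting_set_def balanced_def by (metis order_refl)
next
  assume "\<exists>Y. hitting_set (elems n) (num_targets n (length F)) (target n F) Y \<and> card Y \<le> h * groups n"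
  then obtain Y where Y: "Y \<subseteq> {..<elems n}" "card Y \<le> h * groups n"
    and hits: "\<forall>j < num_targets n (length F). Y \<inter> target n F j \<noteq> {}" unfolding hitting_set_def by blast
  note hits = hits[unfolded all_targets_iff[of n F "\<lambda>A. Y \<inter> A \<noteq> {}"]]
  from balanced_if_hits_balance_sets[OF Y] hits have Y: "balanced n Y" by blast
  show "satisfiable F" unfolding satisfiable_def
  proof (intro exI[of _ "assignment Y"] ballI)
    show "\<exists>(v, b) \<in> set c. assignment Y v = b" if "c \<in> set F" for c
      by (rule satisfied_if_hits_clause_sets[OF Y qcnf that]) (use hits that in simp)
  qed
qed

definition vertices :: "nat \<Rightarrow> nat \<Rightarrow> nat" where
  "vertices n m = elems n * Suc (num_targets n m)"

definition edges :: "nat \<Rightarrow> cnf \<Rightarrow> nat set set" where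
  "edges n F = hitting_edges (elems n) (num_targets n (length F)) (target n F)"

definition budget :: "nat \<Rightarrow> nat \<Rightarrow> nat" where
  "budget n m = h * groups n + num_targets n m * (elems n - 1)"

lemma satisfiable_iff_vertex_cover:
  assumes qcnf: "is_qcnf q n F"
  shows "satisfiable F \<longleftrightarrow>
    (\<exists>X. vertex_cover {0..<vertices n (length F)} (edges n F) X \<and> card X = budget n (length F))"
proof -
  have "h * groups n < elems n" unfolding elems_def using h_pos groups_pos by simp
  from vertex_cover_iff_hitting_set[OF this target_nonempty[OF qcnf]]
  show ?thesis unfolding satisfiable_iff_hitting_set[OF qcnf] vertices_def edges_def budget_def by simp
qed

end

section \<open>Computing the reduction\<close>

definition clause_pos :: "nat list \<Rightarrow> nat \<Rightarrow> nat" where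
  "clause_pos xs c = rec_nat 2 (\<lambda>_ s. s + 1 + cell xs s) c"

definition clause_length :: "nat list \<Rightarrow> nat \<Rightarrow> nat" where
  "clause_length xs c = cell xs (clause_pos xs c)"

definition literal_code :: "nat list \<Rightarrow> nat \<Rightarrow> nat \<Rightarrow> nat" where
  "literal_code xs c i = cell xs (clause_pos xs c + 1 + i)"

lemma clause_pos_simps:
  "clause_pos xs 0 = 2" "clause_pos xs (Suc c) = clause_pos xs c + 1 + clause_length xs c"
  unfolding clause_pos_def clause_length_def by simp_all

lemma polytime_clause_pos:
  assumes "polytime I G c" shows "polytime I G (\<lambda>a. clause_pos (I a) (c a))"
  unfolding clause_pos_def
proof (rule polytime_rec[OF assms polytime_const])
  show "polytime (\<lambda>p. I (fst (fst p))) (with_index (with_index G)) (\<lambda>p. snd p + 1 + cell (I (fst (fst p))) (snd p))"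
    by (intro polytime_add polytime_const polytime_cell polytime_bound_var)
  show "poly_bounded (\<lambda>p. I (fst p)) (with_index G) (\<lambda>p. rec_nat 2 (\<lambda>_ s. s + 1 + cell (I (fst p)) s) (snd p))"
  proof (rule poly_boundedI)
    show "poly_growth (\<lambda>V. 2 + V * (1 + V))" by (intro poly_growth_intros)
    fix p V assume "inputs_le (\<lambda>p. I (fst p)) (with_index G) p V"
    then have V: "fits (I (fst p)) V" "snd p \<le> V" unfolding inputs_le_def with_index_def by auto
    have "clause_pos (I (fst p)) j \<le> 2 + j * (1 + V)" for j
    proof (induction j)
      case (Suc j)
      then show ?case
        using cell_le[OF V(1), of "clause_pos (I (fst p)) j"] by (simp add: clause_pos_simps clause_length_def)
    qed (simp add: clause_pos_simps)
    also have "2 + snd p * (1 + V) \<le> 2 + V * (1 + V)" using V(2) by (intro add_left_mono mult_le_mono1)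
    finally show "rec_nat 2 (\<lambda>_ s. s + 1 + cell (I (fst p)) s) (snd p) \<le> 2 + V * (1 + V)"
      unfolding clause_pos_def .
  qed
qed

lemma polytime_clause_length: "polytime I G c \<Longrightarrow> polytime I G (\<lambda>a. clause_length (I a) (c a))"
  unfolding clause_length_def by (intro polytime_cell polytime_clause_pos)

lemma polytime_literal_code:
  "polytime I G c \<Longrightarrow> polytime I G i \<Longrightarrow> polytime I G (\<lambda>a. literal_code (I a) (c a) (i a))"
  unfolding literal_code_def by (intro polytime_cell polytime_add polytime_const polytime_clause_pos)

lemma polytime_table3:
  assumes u: "polytime I G u" "0 < A" and v: "polytime I G v" "0 < B" and w: "polytime I G w" "0 < C"
  shows "polytime I G (\<lambda>a. f (u a mod A) (v a mod B) (w a mod C))"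
proof (rule polytime_finite_cases[OF u(1) _ u(2)])
  fix x show "polytime I G (\<lambda>a. f x (v a mod B) (w a mod C))"
  proof (rule polytime_finite_cases[OF v(1) _ v(2)])
    fix y show "polytime I G (\<lambda>a. f x y (w a mod C))"
      by (rule polytime_finite_cases[OF w(1) polytime_const w(2)])
  qed
qed

definition encode_clause :: "literal list \<Rightarrow> nat list" where
  "encode_clause c = length c # map encode_literal c"

lemma length_encode_clause [simp]: "length (encode_clause c) = Suc (length c)"
  unfolding encode_clause_def by simp

lemma cell_encode_cnf_header: "cell (encode_cnf n F) 0 = n" "cell (encode_cnf n F) 1 = length F"
  by (simp_all add: cell_def encode_cnf_def)

lemma cell_encode_cnf_clause:
  assumes "c < length F" "i < length (encode_clause (F ! c))"
  shows "cell (encode_cnf n F) (2 + length (concat (take c (map encode_clause F))) + i) = encode_clause (F ! c) ! i"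
proof -
  let ?ys = "map encode_clause F"
  have "?ys = take c ?ys @ encode_clause (F ! c) # drop (Suc c) ?ys"
    using assms(1) id_take_nth_drop[of c ?ys] by simp
  then have "concat ?ys = concat (take c ?ys) @ encode_clause (F ! c) @ concat (drop (Suc c) ?ys)"
    by (metis concat.simps(2) concat_append)
  moreover have "encode_cnf n F = n # length F # concat ?ys"
    unfolding encode_cnf_def encode_clause_def ..
  ultimately show ?thesis unfolding cell_def using assms(2) by (simp add: nth_append)
qed

lemma clause_length_at:
  assumes "c < length F" "clause_pos (encode_cnf n F) c = 2 + length (concat (take c (map encode_clause F)))"
  shows "clause_length (encode_cnf n F) c = length (F ! c)"
  using cell_encode_cnf_clause[OF assms(1), of 0 n] unfolding clause_length_def assms(2) encode_clause_def by simp

lemma clause_pos_encode_cnf: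
  "c \<le> length F \<Longrightarrow> clause_pos (encode_cnf n F) c = 2 + length (concat (take c (map encode_clause F)))"
proof (induction c)
  case (Suc c)
  then show ?case using clause_length_at[of c F n]
    by (simp add: clause_pos_simps take_Suc_conv_app_nth)
qed (simp add: clause_pos_simps)

lemma clause_length_encode_cnf: "c < length F \<Longrightarrow> clause_length (encode_cnf n F) c = length (F ! c)"
  by (simp add: clause_length_at clause_pos_encode_cnf)

lemma literal_code_encode_cnf:
  assumes "c < length F" "i < length (F ! c)"
  shows "literal_code (encode_cnf n F) c i = encode_literal (F ! c ! i)"
  using assms(2) cell_encode_cnf_clause[OF assms(1), of "Suc i" n]
    clause_pos_encode_cnf[OF less_imp_le[OF assms(1)], of n]
  unfolding literal_code_def encode_clause_def by simp

lemma encode_literal_div_mod: "encode_literal l div 2 = fst l" "encode_literal l mod 2 = of_bool (snd l)"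
  by (cases l, simp)+

lemma concat_matrix:
  "concat (map (\<lambda>u. map (f u) [0..<w]) [0..<r]) = map (\<lambda>i. f (i div w) (i mod w)) [0..<r * w]"
proof (induction r)
  case (Suc r)
  have "map (f r) [0..<w] = map (\<lambda>i. f (i div w) (i mod w)) [r * w..<r * w + w]"
    by (rule nth_equalityI) simp_all
  moreover have "[0..<Suc r * w] = [0..<r * w] @ [r * w..<r * w + w]"
    using upt_add_eq_append[of 0 "r * w" w] by (simp add: add.commute)
  ultimately show ?case using Suc by simp
qed simp

lemma map_upt_add: "map f [0..<m + k] = map f [0..<m] @ map (\<lambda>i. f (m + i)) [0..<k]"
  using upt_add_eq_append[of 0 m k] by (auto intro: nth_equalityI)

context group_code
begin

text \<open>
  The reductions modulo \<open>Suc q\<close> change nothing on encodings of formulas. They bound the arguments of the finite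
  tables \<open>tuple\<close> and \<open>dec\<close> on all words.
\<close>

definition in_clause_set :: "nat list \<Rightarrow> nat \<Rightarrow> nat \<Rightarrow> nat \<Rightarrow> bool" where
  "in_clause_set xs c z a \<longleftrightarrow> (\<exists>i \<le> q. h < card (tuple z i)) \<or>
     (\<exists>i < clause_length xs c.
       literal_code xs c i div 2 mod p \<in> dec (tuple z (i mod Suc q)) \<longleftrightarrow> literal_code xs c i mod 2 = 1) \<or>
     (\<exists>i < Suc q. (if i < clause_length xs c then literal_code xs c i div 2 div p else 0) = a div (2 * h) \<and>
       \<not> a mod (2 * h) \<in> tuple z (i mod Suc q))"

definition in_target :: "nat list \<Rightarrow> nat \<Rightarrow> nat \<Rightarrow> bool" where
  "in_target xs j a \<longleftrightarrow> (if j div num_tuples < groups (cell xs 0)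
     then a div (2 * h) = j div num_tuples \<and>
       (card (tuple (j mod num_tuples) 0) \<le> h \<or> a mod (2 * h) \<in> tuple (j mod num_tuples) (0 mod Suc q))
     else in_clause_set xs (j div num_tuples - groups (cell xs 0)) (j mod num_tuples) a)"

definition num_vertices :: "nat list \<Rightarrow> nat" where
  "num_vertices xs = vertices (cell xs 0) (cell xs 1)"

definition graph_cell :: "nat list \<Rightarrow> nat \<Rightarrow> nat" where
  "graph_cell xs i =
    (if i = 0 then num_vertices xs
     else if i = 1 then elems (cell xs 0)
     else if i = 2 then budget (cell xs 0) (cell xs 1)
     else if i - 3 < num_vertices xs * num_vertices xs
     then of_bool (hitting_adj (elems (cell xs 0)) (\<lambda>j. {a. in_target xs j a})
       ((i - 3) div num_vertices xs) ((i - 3) mod num_vertices xs))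
     else of_bool (i - 3 - num_vertices xs * num_vertices xs < elems (cell xs 0)))"

lemma polytime_groups: "polytime I G u \<Longrightarrow> polytime I G (\<lambda>a. groups (u a))"
  unfolding groups_def by (intro polytime_add polytime_div polytime_const)

lemma polytime_elems: "polytime I G u \<Longrightarrow> polytime I G (\<lambda>a. elems (u a))"
  unfolding elems_def by (intro polytime_mult polytime_groups polytime_const)

lemma polytime_num_targets: "polytime I G u \<Longrightarrow> polytime I G v \<Longrightarrow> polytime I G (\<lambda>a. num_targets (u a) (v a))"
  unfolding num_targets_def by (intro polytime_mult polytime_add polytime_groups polytime_const)

lemma polytime_num_vertices: "polytime I G (\<lambda>a. num_vertices (I a))"
  unfolding num_vertices_def vertices_def Suc_eq_plus1
  by (intro polytime_mult polytime_add polytime_elems polytime_num_targets polytime_cell polytime_const)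

lemma polytime_budget: "polytime I G u \<Longrightarrow> polytime I G v \<Longrightarrow> polytime I G (\<lambda>a. budget (u a) (v a))"
  unfolding budget_def
  by (intro polytime_mult polytime_add polytime_diff polytime_groups polytime_elems polytime_num_targets polytime_const)

lemma polytime_in_tuple:
  "polytime I G a \<Longrightarrow> polytime I G j \<Longrightarrow> polytime I G i \<Longrightarrow>
    polytime_pred I G (\<lambda>x. a x mod (2 * h) \<in> tuple (j x mod num_tuples) (i x mod Suc q))"
  by (rule polytime_table3[where f = "\<lambda>r z i. of_bool (r \<in> tuple z i)"]) (simp_all add: h_pos num_tuples_pos)

lemma polytime_in_dec_tuple:
  "polytime I G v \<Longrightarrow> polytime I G j \<Longrightarrow> polytime I G i \<Longrightarrow>
    polytime_pred I G (\<lambda>x. v x mod p \<in> dec (tuple (j x mod num_tuples) (i x mod Suc q)))"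
  by (rule polytime_table3[where f = "\<lambda>r z i. of_bool (r \<in> dec (tuple z i))"]) (simp_all add: p_pos num_tuples_pos)

lemma polytime_tuple_table:
  "polytime I G j \<Longrightarrow> polytime_pred I G (\<lambda>x. Q (j x mod num_tuples))"
  by (rule polytime_finite_cases[OF _ polytime_const num_tuples_pos])

lemma polytime_in_target:
  assumes j: "polytime I G j" and a: "polytime I G a"
  shows "polytime_pred I G (\<lambda>x. in_target (I x) (j x) (a x))"
  unfolding in_target_def in_clause_set_def if_bool_eq_disj
  by (intro polytime_disj polytime_conj polytime_not polytime_less polytime_eq polytime_iff polytime_bounded_ex
      polytime_in_tuple polytime_in_dec_tuple polytime_tuple_table polytime_If
      polytime_div[OF _ polytime_const] polytime_mod[OF _ polytime_const]
      polytime_literal_code polytime_clause_length polytime_cell polytime_diff polytime_groups polytime_const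
      polytime_bound_var j a polytime_lift[OF j] polytime_lift[OF a])

lemma polytime_graph_cell:
  assumes i: "polytime I G i" shows "polytime I G (\<lambda>a. graph_cell (I a) (i a))"
  unfolding graph_cell_def hitting_adj_def slot_edge_def mem_Collect_eq
  by (intro polytime_If polytime_disj polytime_conj polytime_not polytime_less polytime_le polytime_eq
      polytime_in_target polytime_div polytime_mod polytime_mult polytime_cell polytime_diff
      polytime_num_vertices polytime_elems polytime_budget polytime_const i)

end

context group_code
begin

lemma num_vertices_encode_cnf: "num_vertices (encode_cnf n F) = vertices n (length F)"
  unfolding num_vertices_def cell_encode_cnf_header ..

lemma in_clause_set_encode_cnf:
  assumes qcnf: "is_qcnf q n F" and c: "c < length F" and a: "a < elems n"
  shows "in_clause_set (encode_cnf n F) c z a \<longleftrightarrow> a \<in> clause_set n (F ! c) z"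
proof -
  have "length (F ! c) \<le> q" using is_qcnf_clause(1)[OF qcnf nth_mem[OF c]] .
  then show ?thesis
    using a unfolding in_clause_set_def clause_set_def clause_group_def falsified_def clause_length_encode_cnf[OF c]
    by (auto simp: literal_code_encode_cnf[OF c] encode_literal_div_mod less_Suc_eq_le cong: conj_cong)
qed

lemma in_target_encode_cnf:
  assumes qcnf: "is_qcnf q n F" and j: "j < num_targets n (length F)" and a: "a < elems n"
  shows "in_target (encode_cnf n F) j a \<longleftrightarrow> a \<in> target n F j"
proof (cases "j div num_tuples < groups n")
  case True
  then show ?thesis unfolding in_target_def target_def balance_set_def cell_encode_cnf_header using a by simp
next
  case False
  have "j div num_tuples < groups n + length F"
    using j unfolding num_targets_def by (simp add: less_mult_imp_div_less)
  then have "j div num_tuples - groups n < length F" using False by simp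
  from in_clause_set_encode_cnf[OF qcnf this a] False show ?thesis
    unfolding in_target_def target_def cell_encode_cnf_header by simp
qed

lemma hitting_adj_encode_cnf:
  assumes qcnf: "is_qcnf q n F" and uv: "u < vertices n (length F)" "v < vertices n (length F)"
  shows "hitting_adj (elems n) (\<lambda>j. {a. in_target (encode_cnf n F) j a}) u v \<longleftrightarrow> {u, v} \<in> edges n F"
proof -
  have "in_target (encode_cnf n F) (y div elems n - 1) (y mod elems n) \<longleftrightarrow> y mod elems n \<in> target n F (y div elems n - 1)"
    if "elems n \<le> y" "y < vertices n (length F)" for y
  proof -
    from slot_exists[OF that[unfolded vertices_def]] obtain j b
      where "j < num_targets n (length F)" "b < elems n" "y = elems n * Suc j + b" by blast
    then show ?thesis using in_target_encode_cnf[OF qcnf] by (simp add: slot_simps del: mult_Suc_right)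
  qed
  from this[OF _ uv(1)] this[OF _ uv(2)] show ?thesis
    unfolding edges_def hitting_edges_iff[OF uv[unfolded vertices_def]] hitting_adj_def slot_edge_def by auto
qed

lemma map_graph_cell_adjacency:
  assumes qcnf: "is_qcnf q n F"
  defines "N \<equiv> vertices n (length F)"
  shows "map (\<lambda>i. graph_cell (encode_cnf n F) (3 + i)) [0..<N * N] = adjacency_bits N (edges n F)"
  unfolding adjacency_bits_def concat_matrix
proof (rule map_cong)
  fix i assume "i \<in> set [0..<N * N]"
  then have i: "i < N * N" by simp
  then have "0 < N" by (cases N) auto
  then have "i div N < N" "i mod N < N" using i by (simp_all add: less_mult_imp_div_less)
  from hitting_adj_encode_cnf[OF qcnf this[unfolded N_def]] i
  show "graph_cell (encode_cnf n F) (3 + i) = of_bool ({i div N, i mod N} \<in> edges n F)"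
    unfolding graph_cell_def cell_encode_cnf_header num_vertices_encode_cnf N_def by simp
qed simp

lemma map_graph_cell:
  assumes qcnf: "is_qcnf q n F"
  defines "N \<equiv> vertices n (length F)"
  shows "map (graph_cell (encode_cnf n F)) [0..<3 + N * N] =
    N # elems n # budget n (length F) # adjacency_bits N (edges n F)"
proof -
  have "map (graph_cell (encode_cnf n F)) [0..<3] = [N, elems n, budget n (length F)]"
    unfolding graph_cell_def cell_encode_cnf_header num_vertices_encode_cnf N_def by (simp add: upt_rec)
  then show ?thesis unfolding map_upt_add map_graph_cell_adjacency[OF qcnf, folded N_def] by simp
qed

lemma map_graph_cell_membership:
  assumes qcnf: "is_qcnf q n F"
  defines "N \<equiv> vertices n (length F)"
  shows "map (graph_cell (encode_cnf n F)) [0..<3 + N * N + N] =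
    N # elems n # budget n (length F) # adjacency_bits N (edges n F) @ membership_bits N {0..<elems n}"
proof -
  have "map (\<lambda>i. graph_cell (encode_cnf n F) (3 + N * N + i)) [0..<N] = membership_bits N {0..<elems n}"
    unfolding membership_bits_def graph_cell_def cell_encode_cnf_header num_vertices_encode_cnf N_def by simp
  then show ?thesis unfolding map_upt_add[of _ "3 + N * N"] map_graph_cell[OF qcnf, folded N_def] by simp
qed

end

section \<open>The lower bound\<close>

lemma power_le_exponential:
  fixes \<eta> :: real
  assumes "0 < \<eta>"
  shows "\<exists>A>0. \<forall>n::nat. real (n + b) ^ K \<le> A * 2 powr (\<eta> * real n)"
proof -
  define \<theta> where "\<theta> = \<eta> * ln 2 / (K + 1)"
  have \<theta>: "0 < \<theta>" unfolding \<theta>_def using assms by simp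
  define A where "A = exp (\<eta> * ln 2 * b) / \<theta> ^ K"
  have "real (n + b) ^ K \<le> A * 2 powr (\<eta> * real n)" for n
  proof -
    have "(\<theta> * real (n + b)) ^ K \<le> exp (\<theta> * real (n + b)) ^ K"
      using \<theta> exp_ge_add_one_self[of "\<theta> * real (n + b)"] by (intro power_mono) (auto simp del: exp_ge_add_one_self)
    also have "\<dots> = exp (K * (\<theta> * real (n + b)))" by (simp add: exp_of_nat_mult)
    also have "\<dots> \<le> exp ((K + 1) * (\<theta> * real (n + b)))"
      unfolding exp_le_cancel_iff by (intro mult_right_mono) (use \<theta> in auto)
    also have "(K + 1) * (\<theta> * real (n + b)) = \<eta> * ln 2 * b + \<eta> * real n * ln 2"
      unfolding \<theta>_def by (simp add: field_simps)
    finally have "\<theta> ^ K * real (n + b) ^ K \<le> exp (\<eta> * ln 2 * b) * 2 powr (\<eta> * real n)"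
      by (simp add: power_mult_distrib exp_add powr_def)
    then show ?thesis unfolding A_def using \<theta> by (simp add: field_simps)
  qed
  moreover have "0 < A" unfolding A_def using \<theta> by simp
  ultimately show ?thesis by blast
qed

lemma length_le_input_size: "length xs \<le> input_size xs"
  unfolding input_size_def by (induction xs) auto

lemma two_le_input_size_encode_cnf: "2 \<le> input_size (encode_cnf n F)"
  using length_le_input_size[of "encode_cnf n F"] by (simp add: encode_cnf_def)

lemma fits_encode_cnf:
  assumes qcnf: "is_qcnf q n F"
  shows "fits (encode_cnf n F) (2 * n + q + input_size (encode_cnf n F))"
  unfolding fits_def
proof (intro conjI ballI)
  let ?s = "input_size (encode_cnf n F)"
  have len: "length (encode_cnf n F) \<le> ?s" by (rule length_le_input_size)
  then show "length (encode_cnf n F) \<le> 2 * n + q + ?s" by simp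
  fix x assume "x \<in> set (encode_cnf n F)"
  then consider "x = n" | "x = length F" | c where "c \<in> set F" "x = length c"
    | c l where "c \<in> set F" "l \<in> set c" "x = encode_literal l"
    unfolding encode_cnf_def by auto
  then show "x \<le> 2 * n + q + ?s"
  proof cases
    case 2
    have "length F \<le> length (concat (map (\<lambda>c. length c # map encode_literal c) F))"
      by (induction F) auto
    then show ?thesis using 2 len unfolding encode_cnf_def by simp
  next
    case 3
    then show ?thesis using is_qcnf_clause(1)[OF qcnf] by fastforce
  next
    case 4
    then have "fst l < n" using is_qcnf_clause(2)[OF qcnf] by (metis in_set_conv_nth)
    then show ?thesis using 4 by (cases l) auto
  qed simp
qed

context group_code
begin

lemma power_elems_le:
  fixes \<beta> :: real
  assumes "1 \<le> \<beta>"
  shows "\<beta> ^ elems n \<le> \<beta> ^ (2 * h) * 2 powr (real (2 * h) / real p * log 2 \<beta> * real n)"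
proof -
  have "real (n div p) * real p \<le> real n" by (metis div_times_less_eq_dividend of_nat_le_iff of_nat_mult)
  then have quotient: "real (n div p) \<le> real n / real p" using p_pos by (simp add: field_simps)
  have "\<beta> ^ elems n = \<beta> ^ (2 * h) * \<beta> ^ (2 * h * (n div p))"
    unfolding elems_def groups_def by (simp add: power_add[symmetric] algebra_simps)
  also have "\<beta> ^ (2 * h * (n div p)) = \<beta> powr (real (2 * h) * real (n div p))"
    using assms by (simp add: powr_realpow[symmetric])
  also have "\<dots> \<le> \<beta> powr (real (2 * h) * (real n / real p))"
    using assms quotient by (intro powr_mono mult_left_mono) auto
  also have "\<dots> = 2 powr (real (2 * h) / real p * log 2 \<beta> * real n)"
    using assms by (simp add: powr_def log_def field_simps)
  finally show ?thesis using assms by simp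
qed

lemma reduction_time_le:
  fixes \<beta> \<delta> :: real
  assumes \<beta>: "1 \<le> \<beta>" and rate: "real (2 * h) / real p * log 2 \<beta> < \<delta>"
  shows "\<exists>C>0. \<forall>n s. 2 \<le> s \<longrightarrow>
    (1 + \<beta> ^ elems n) * real (2 * n + q + s + 2) ^ K \<le> C * 2 powr (\<delta> * real n) * real s ^ K"
proof -
  define \<rho> \<eta> where "\<rho> = real (2 * h) / real p * log 2 \<beta>" and "\<eta> = \<delta> - \<rho>"
  have "0 < \<eta>" using rate unfolding \<eta>_def \<rho>_def by simp
  then obtain A where A: "0 < A" "\<And>n::nat. real (n + (q + 2)) ^ K \<le> A * 2 powr (\<eta> * real n)"
    using power_le_exponential by blast
  define C where "C = 2 * \<beta> ^ (2 * h) * A"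
  have "(1 + \<beta> ^ elems n) * real (2 * n + q + s + 2) ^ K \<le> C * 2 powr (\<delta> * real n) * real s ^ K" if s: "2 \<le> s" for n s
  proof -
    have "2 * n + q + s + 2 \<le> (n + q + 1) * 2 + s" by simp
    also have "\<dots> \<le> (n + q + 1) * s + s" using mult_le_mono2[OF s, of "n + q + 1"] by simp
    also have "\<dots> = (n + (q + 2)) * s" by (simp add: algebra_simps)
    finally have "real (2 * n + q + s + 2) ^ K \<le> (real (n + (q + 2)) * real s) ^ K"
      by (intro power_mono) (metis of_nat_le_iff of_nat_mult, simp)
    also have "\<dots> \<le> A * 2 powr (\<eta> * real n) * real s ^ K"
      unfolding power_mult_distrib using A(2)[of n] by (intro mult_right_mono) auto
    finally have input: "real (2 * n + q + s + 2) ^ K \<le> A * 2 powr (\<eta> * real n) * real s ^ K" .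
    have "1 + \<beta> ^ elems n \<le> 2 * \<beta> ^ elems n" using one_le_power[OF \<beta>] by simp
    also have "\<dots> \<le> 2 * (\<beta> ^ (2 * h) * 2 powr (\<rho> * real n))" using power_elems_le[OF \<beta>] unfolding \<rho>_def by simp
    finally have "(1 + \<beta> ^ elems n) * real (2 * n + q + s + 2) ^ K \<le>
        2 * (\<beta> ^ (2 * h) * 2 powr (\<rho> * real n)) * (A * 2 powr (\<eta> * real n) * real s ^ K)"
      using input \<beta> by (intro mult_mono) auto
    also have "\<dots> = C * (2 powr (\<rho> * real n) * 2 powr (\<eta> * real n)) * real s ^ K"
      unfolding C_def by (simp only: mult_ac)
    also have "2 powr (\<rho> * real n) * 2 powr (\<eta> * real n) = 2 powr (\<delta> * real n)"
      unfolding powr_add[symmetric] \<eta>_def by (simp add: algebra_simps)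
    finally show ?thesis .
  qed
  moreover have "0 < C" unfolding C_def using \<beta> A(1) by simp
  ultimately show ?thesis by blast
qed

lemma SAT_solvable_by_reduction:
  fixes \<beta> \<delta> :: real
  assumes solv: "solvable_Ostar B (\<lambda>k. \<beta> ^ k)" and len: "polytime (\<lambda>xs. xs) {} len"
    and reduces: "\<And>n F. is_qcnf q n F \<Longrightarrow> r n F \<in> instances B \<and>
      encode B (r n F) = map (graph_cell (encode_cnf n F)) [0..<len (encode_cnf n F)] \<and>
      param B (r n F) = elems n \<and> (yes_instance B (r n F) \<longleftrightarrow> satisfiable F)"
    and \<beta>: "1 \<le> \<beta>" and rate: "real (2 * h) / real p * log 2 \<beta> < \<delta>"
  shows "solvable_Ostar (SAT q) (\<lambda>n. 2 powr (\<delta> * real n))"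
proof (rule solvable_Ostar_reduction[OF solv])
  have "polytime fst {snd} (\<lambda>p. graph_cell (fst p) (snd p))"
    by (rule polytime_graph_cell, rule polytime_var) simp
  then show "polytime_map (\<lambda>xs. map (graph_cell xs) [0..<len xs])" by (rule polytime_mapI[OF len])
  let ?r = "\<lambda>(n, F). r n F" and ?V = "\<lambda>(n, F). 2 * n + q + input_size (encode_cnf n F)"
  fix x assume "x \<in> instances (SAT q)"
  then obtain n F where x: "x = (n, F)" "is_qcnf q n F" unfolding SAT_def by auto
  then show "?r x \<in> instances B \<and> encode B (?r x) = map (graph_cell (encode (SAT q) x)) [0..<len (encode (SAT q) x)] \<and>
      (yes_instance B (?r x) \<longleftrightarrow> yes_instance (SAT q) x)"
    using reduces by (simp add: SAT_def)
  show "fits (encode (SAT q) x) (?V x)" using x fits_encode_cnf by (simp add: SAT_def)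
next
  let ?r = "\<lambda>(n, F). r n F" and ?V = "\<lambda>(n, F). 2 * n + q + input_size (encode_cnf n F)"
  fix K
  obtain C where C: "0 < C" "\<And>n s. 2 \<le> s \<Longrightarrow>
      (1 + \<beta> ^ elems n) * real (2 * n + q + s + 2) ^ K \<le> C * 2 powr (\<delta> * real n) * real s ^ K"
    using reduction_time_le[OF \<beta> rate] by blast
  have "(1 + \<beta> ^ param B (?r x)) * real (?V x + 2) ^ K \<le>
      C * 2 powr (\<delta> * real (param (SAT q) x)) * real (input_size (encode (SAT q) x)) ^ K"
    if "x \<in> instances (SAT q)" for x
  proof -
    from that obtain n F where x: "x = (n, F)" "is_qcnf q n F" unfolding SAT_def by auto
    let ?s = "input_size (encode_cnf n F)"
    have "(1 + \<beta> ^ elems n) * real (2 * n + q + ?s + 2) ^ K \<le> C * 2 powr (\<delta> * real n) * real ?s ^ K"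
      by (rule C(2)[OF two_le_input_size_encode_cnf])
    then show ?thesis using reduces[OF x(2)] by (simp add: x(1) SAT_def)
  qed
  with C(1) show "\<exists>C>0. \<exists>c. \<forall>x \<in> instances (SAT q). (1 + \<beta> ^ param B (?r x)) * real (?V x + 2) ^ K \<le>
      C * 2 powr (\<delta> * real (param (SAT q) x)) * real (input_size (encode (SAT q) x)) ^ c"
    by blast
qed (use \<beta> in simp)

lemma simple_graph_edges: "simple_graph {0..<vertices n (length F)} (edges n F)"
  unfolding vertices_def edges_def by (rule simple_graph_hitting_edges)

lemma chordal_deletion_set_edges: "chordal_deletion_set {0..<vertices n (length F)} (edges n F) {0..<elems n}"
  unfolding vertices_def edges_def by (rule chordal_deletion_set_elements)

lemma SAT_solvable_by_CVD:
  fixes \<beta> \<delta> :: real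
  assumes "solvable_Ostar VC_by_CVD (\<lambda>k. \<beta> ^ k)"
    and \<beta>: "1 \<le> \<beta>" and rate: "real (2 * h) / real p * log 2 \<beta> < \<delta>"
  shows "solvable_Ostar (SAT q) (\<lambda>n. 2 powr (\<delta> * real n))"
proof (rule SAT_solvable_by_reduction[OF assms(1) _ _ \<beta> rate])
  let ?len = "\<lambda>xs. 3 + num_vertices xs * num_vertices xs"
  show "polytime (\<lambda>xs. xs) {} ?len"
    by (intro polytime_add polytime_mult polytime_num_vertices polytime_const)
  fix n F assume qcnf: "is_qcnf q n F"
  let ?x = "(vertices n (length F), edges n F, elems n, budget n (length F))"
  have "?x \<in> instances VC_by_CVD"
    using simple_graph_edges chordal_deletion_set_edges by (auto simp: VC_by_CVD_def intro!: exI[of _ "{0..<elems n}"])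
  then show "?x \<in> instances VC_by_CVD \<and>
      encode VC_by_CVD ?x = map (graph_cell (encode_cnf n F)) [0..<?len (encode_cnf n F)] \<and>
      param VC_by_CVD ?x = elems n \<and> (yes_instance VC_by_CVD ?x \<longleftrightarrow> satisfiable F)"
    unfolding num_vertices_encode_cnf map_graph_cell[OF qcnf] satisfiable_iff_vertex_cover[OF qcnf]
    by (simp add: VC_by_CVD_def)
qed

lemma SAT_solvable_by_given_CVD:
  fixes \<beta> \<delta> :: real
  assumes "solvable_Ostar VC_by_given_CVD (\<lambda>k. \<beta> ^ k)"
    and \<beta>: "1 \<le> \<beta>" and rate: "real (2 * h) / real p * log 2 \<beta> < \<delta>"
  shows "solvable_Ostar (SAT q) (\<lambda>n. 2 powr (\<delta> * real n))"
proof (rule SAT_solvable_by_reduction[OF assms(1) _ _ \<beta> rate])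
  let ?len = "\<lambda>xs. 3 + num_vertices xs * num_vertices xs + num_vertices xs"
  show "polytime (\<lambda>xs. xs) {} ?len"
    by (intro polytime_add polytime_mult polytime_num_vertices polytime_const)
  fix n F assume qcnf: "is_qcnf q n F"
  let ?x = "(vertices n (length F), edges n F, {0..<elems n}, elems n, budget n (length F))"
  have "?x \<in> instances VC_by_given_CVD"
    using simple_graph_edges chordal_deletion_set_edges by (simp add: VC_by_given_CVD_def)
  then show "?x \<in> instances VC_by_given_CVD \<and>
      encode VC_by_given_CVD ?x = map (graph_cell (encode_cnf n F)) [0..<?len (encode_cnf n F)] \<and>
      param VC_by_given_CVD ?x = elems n \<and> (yes_instance VC_by_given_CVD ?x \<longleftrightarrow> satisfiable F)"
    unfolding num_vertices_encode_cnf map_graph_cell_membership[OF qcnf] satisfiable_iff_vertex_cover[OF qcnf]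
    by (simp add: VC_by_given_CVD_def)
qed

end

lemma group_code_exists:
  assumes "0 < p" "0 < h" and card: "2 ^ p \<le> (2 * h) choose h"
  shows "\<exists>dec. group_code p h dec"
proof -
  let ?H = "{X. X \<subseteq> {..<2 * h} \<and> card X = h}"
  have "card (Pow {..<p}) \<le> card ?H" using card n_subsets[of "{..<2 * h}" h] by (simp add: card_Pow)
  then obtain f where f: "inj_on f (Pow {..<p})" "f ` Pow {..<p} \<subseteq> ?H"
    using inj_on_iff_card_le[of "Pow {..<p}" ?H] by auto
  have "group_code p h (inv_into (Pow {..<p}) f)"
  proof
    fix A assume A: "A \<subseteq> {..<p}"
    then have "f A \<in> ?H" using f(2) by blast
    then show "\<exists>X \<subseteq> {..<2 * h}. card X = h \<and> inv_into (Pow {..<p}) f X = A"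
      using f(1) A by (intro exI[of _ "f A"]) simp
  qed (use assms in simp_all)
  then show ?thesis by blast
qed

lemma two_power_le_central_binomial:
  assumes h: "2 * h = 2 ^ J" shows "2 ^ (2 * h - J) \<le> (2 * h) choose h"
proof -
  have "0 < h" using h by (cases h) auto
  have "J \<le> 2 * h" unfolding h using less_exp[of J] by simp
  then have "(2 :: real) ^ (2 * h - J) = 4 ^ h / real (2 ^ J)" by (simp add: power_diff power_mult)
  also have "\<dots> = 4 ^ h / (2 * real h)" unfolding h[symmetric] by simp
  also have "\<dots> \<le> real ((2 * h) choose h)" by (rule central_binomial_lower_bound[OF \<open>0 < h\<close>])
  finally show ?thesis by (metis of_nat_le_iff of_nat_numeral of_nat_power)
qed

lemma dense_group_exists:
  fixes r :: real
  assumes "r < 1"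
  shows "\<exists>p h. 0 < p \<and> 0 < h \<and> 2 ^ p \<le> (2 * h) choose h \<and> real (2 * h) / real p * r < 1"
proof -
  have "(\<lambda>J. real J / 2 ^ J) \<longlonglongrightarrow> 0" using lim_n_over_pown[of "2 :: real"] by simp
  then have "eventually (\<lambda>J. real J / 2 ^ J < 1 - r) sequentially"
    by (rule order_tendstoD) (use assms in simp)
  then obtain J where J: "0 < J" "real J / 2 ^ J < 1 - r"
    using eventually_gt_at_top[of 0] eventually_conj eventually_happens' sequentially_bot
    by (metis (mono_tags, lifting))
  define h :: nat where "h = 2 ^ (J - 1)"
  have h: "2 * h = 2 ^ J" unfolding h_def using J(1) by (cases J) auto
  have "J < 2 * h" unfolding h by simp
  moreover have "real (2 * h) * r < real (2 * h - J)"
    using J(2) \<open>J < 2 * h\<close> unfolding of_nat_diff[OF less_imp_le[OF \<open>J < 2 * h\<close>]] h by (simp add: field_simps)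
  ultimately have "real (2 * h) / real (2 * h - J) * r < 1" by (simp add: field_simps)
  moreover have "0 < 2 * h - J" "0 < h" using \<open>J < 2 * h\<close> by simp_all
  ultimately show ?thesis using two_power_le_central_binomial[OF h] by blast
qed

lemma exec_time_pos: "exec P s t s' \<Longrightarrow> 0 < t"
  by (induction rule: exec.induct) auto

text \<open>For \<open>\<epsilon> \<ge> 2\<close> the time bound is not positive at \<open>k = 1\<close>.\<close>

lemma not_solvable_nonpositive_base:
  fixes \<gamma> :: real
  assumes "\<gamma> \<le> 0" "x \<in> instances A" "param A x = 1"
  shows "\<not> solvable_Ostar A (\<lambda>k. \<gamma> ^ k)"
proof
  assume "solvable_Ostar A (\<lambda>k. \<gamma> ^ k)"
  then obtain P C c t s where "0 < C" and t: "exec P (init (encode A x)) t s"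
    "real t \<le> C * \<gamma> * real (input_size (encode A x)) ^ c"
    using assms(2,3) unfolding solvable_Ostar_def by (metis power_one_right)
  then have "real t \<le> 0"
    using assms(1) by (smt (verit) mult_nonneg_nonpos mult_nonpos_nonneg of_nat_0_le_iff zero_le_power)
  then show False using exec_time_pos[OF t(1)] by simp
qed

lemma not_solvable_CVD_nonpositive_base:
  fixes \<gamma> :: real
  assumes "\<gamma> \<le> 0"
  shows "\<not> solvable_Ostar VC_by_CVD (\<lambda>k. \<gamma> ^ k)" "\<not> solvable_Ostar VC_by_given_CVD (\<lambda>k. \<gamma> ^ k)"
proof -
  have "chordal_deletion_set {0..<1::nat} {} {0}"
    by (auto simp: chordal_deletion_set_def chordal_def is_cycle_def)
  then have "(1, {}, 1, 0) \<in> instances VC_by_CVD" "(1, {}, {0}, 1, 0) \<in> instances VC_by_given_CVD"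
    unfolding VC_by_CVD_def VC_by_given_CVD_def by (auto simp: simple_graph_def intro!: exI[of _ "{0}"])
  then show "\<not> solvable_Ostar VC_by_CVD (\<lambda>k. \<gamma> ^ k)" "\<not> solvable_Ostar VC_by_given_CVD (\<lambda>k. \<gamma> ^ k)"
    using not_solvable_nonpositive_base[OF assms] by (fastforce simp: VC_by_CVD_def VC_by_given_CVD_def)+
qed

lemma SAT_solvable_if_CVD_solvable:
  fixes \<beta> :: real
  assumes "solvable_Ostar VC_by_CVD (\<lambda>k. \<beta> ^ k) \<or> solvable_Ostar VC_by_given_CVD (\<lambda>k. \<beta> ^ k)" "1 \<le> \<beta>" "\<beta> < 2"
  shows "\<exists>\<delta><1. \<forall>q. solvable_Ostar (SAT q) (\<lambda>n. 2 powr (\<delta> * real n))"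
proof -
  have "log 2 \<beta> < 1" using assms(2,3) by simp
  from dense_group_exists[OF this] obtain p h where ph: "0 < p" "0 < h" "2 ^ p \<le> (2 * h) choose h"
    and "real (2 * h) / real p * log 2 \<beta> < 1" by blast
  then obtain \<delta> where \<delta>: "real (2 * h) / real p * log 2 \<beta> < \<delta>" "\<delta> < 1" using dense by blast
  obtain dec where "group_code p h dec" using group_code_exists[OF ph] by blast
  then have "solvable_Ostar (SAT q) (\<lambda>n. 2 powr (\<delta> * real n))" for q
    using assms(1) group_code.SAT_solvable_by_CVD group_code.SAT_solvable_by_given_CVD assms(2) \<delta>(1) by blast
  with \<delta>(2) show ?thesis by blast
qed

theorem theorem4p4:
  assumes "SETH"
  shows "\<forall>\<epsilon>::real. \<epsilon> > 0 \<longrightarrow>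
           \<not> solvable_Ostar VC_by_CVD (\<lambda>k. (2 - \<epsilon>) ^ k) \<and>
           \<not> solvable_Ostar VC_by_given_CVD (\<lambda>k. (2 - \<epsilon>) ^ k)"
proof (intro allI impI)
  fix \<epsilon> :: real assume "0 < \<epsilon>"
  show "\<not> solvable_Ostar VC_by_CVD (\<lambda>k. (2 - \<epsilon>) ^ k) \<and> \<not> solvable_Ostar VC_by_given_CVD (\<lambda>k. (2 - \<epsilon>) ^ k)"
  proof (cases "2 - \<epsilon> \<le> 0")
    case True
    then show ?thesis by (simp add: not_solvable_CVD_nonpositive_base)
  next
    case False
    define \<beta> where "\<beta> = max (2 - \<epsilon>) 1"
    have \<beta>: "1 \<le> \<beta>" "\<beta> < 2" using \<open>0 < \<epsilon>\<close> unfolding \<beta>_def by auto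
    have base: "(2 - \<epsilon>) ^ k \<le> \<beta> ^ k" for k using False unfolding \<beta>_def by (intro power_mono) auto
    have "\<not> (\<exists>\<delta><1. \<forall>q. solvable_Ostar (SAT q) (\<lambda>n. 2 powr (\<delta> * real n)))"
      using assms unfolding SETH_def by blast
    then have "\<not> solvable_Ostar VC_by_CVD (\<lambda>k. \<beta> ^ k) \<and> \<not> solvable_Ostar VC_by_given_CVD (\<lambda>k. \<beta> ^ k)"
      using SAT_solvable_if_CVD_solvable[OF _ \<beta>] by blast
    then show ?thesis by (blast dest: solvable_Ostar_mono[where g = "\<lambda>k. \<beta> ^ k", OF _ base])
  qed
qed

end
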